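(* Let $Q$ be a connected algebraic group over an algebraically closed field $\Bbbk$ of characteristic zero, with Lie algebra $\mathfrak q$. Suppose that $\mathfrak q$ satisfies the codim--$2$ property and $\mathrm{trdeg}\,\mathcal Z(\mathfrak q)=\mathrm{ind}\,\mathfrak q$. Let $P\subset\mathfrak q^*$ be a plane (a two-dimensional linear subspace) such that $P\setminus\{0\}\subset\mathfrak q^*_{reg}$. Suppose that $$\dim\mathrm{span}\{(\mathrm df)_{\xi_0}\mid f\in\mathcal Z(\mathfrak q)\}=\mathrm{ind}\,\mathfrak q\quad\text{for some }\xi_0\in P.$$ Then $$\dim\mathrm{span}\{(\mathrm df)_\eta\mid f\in\mathcal F_\xi(\mathcal Z(\mathfrak q))\}=b(\mathfrak q)$$ for any linearly independent $\xi$ and $\eta$ in $P$.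
   Context: The symmetric algebra $\mathcal S(\mathfrak q)$ is identified with the polynomial algebra $\Bbbk[\mathfrak q^*]$. For $f\in\mathcal S(\mathfrak q)$ and $\eta\in\mathfrak q^*$, the differential $(\mathrm df)_\eta\in\mathfrak q$ is defined by: $\langle(\mathrm df)_\eta,\nu\rangle$ is the coefficient of $t$ in $f(\eta+t\nu)$, for $\nu\in\mathfrak q^*$. The Lie-Poisson bracket on $\mathcal S(\mathfrak q)$ is $\{f,g\}(\eta)=\langle\eta,[(\mathrm df)_\eta,(\mathrm dg)_\eta]\rangle$. Its Poisson centre is denoted $\mathcal Z(\mathfrak q)$; it equals $\mathcal S(\mathfrak q)^Q=\Bbbk[\mathfrak q^*]^Q$. The transcendence degree of a subalgebra of $\mathcal S(\mathfrak q)$ is that of its quotient field over $\Bbbk$. For $\xi\in\mathfrak q^*$, $\mathfrak q_\xi=\{x\in\mathfrak q\mid\langle\xi,[x,y]\rangle=0\ \forall y\in\mathfrak q\}$ is its stabiliser for the coadjoint representation. $\mathfrak q^*_{reg}$ is the set of $\xi\in\mathfrak q^*$ for which $\dim\mathfrak q_\xi$ is minimal (equivalently, the coadjoint orbit $Q\cdot\xi$ has maximal dimension); it is a dense open subset of $\mathfrak q^*$. The index $\mathrm{ind}\,\mathfrak q$ is this minimal dimension, and $b(\mathfrak q)=(\dim\mathfrak q+\mathrm{ind}\,\mathfrak q)/2$. The codim--$n$ property means $\mathrm{codim}(\mathfrak q^*\setminus\mathfrak q^*_{reg})\ge n$ (codimension in the Zariski topology; the empty set has codimension $\infty$). Argument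 shift: for $f\in\mathcal S(\mathfrak q)$ of degree $d$ and $\xi\in\mathfrak q^*$, write $f(\mu+a\xi)=\sum_{j=0}^d f_\xi^j(\mu)a^j$ for $\mu\in\mathfrak q^*$, $a\in\Bbbk$. The polynomials $f_\xi^j\in\mathcal S(\mathfrak q)$, $j=0,1,\ldots,d-1$, are called the $\xi$-shifts of $f$. $\mathcal F_\xi(\mathcal Z(\mathfrak q))$ is the subalgebra of the associative commutative algebra $\mathcal S(\mathfrak q)$ generated by the $\xi$-shifts of all elements of $\mathcal Z(\mathfrak q)$. *)

theory Defs
  imports
    "HOL-Analysis.Analysis"
    "HOL-Algebra.Finite_Extensions"
    "HOL-Algebra.Generated_Fields"
    "HOL-Library.Function_Algebras"
begin

section \<open>Vector spaces of matrices and of functions\<close>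

definition mscale :: "'k::field \<Rightarrow> 'k^'n^'m \<Rightarrow> 'k^'n^'m"
  where "mscale c A = (\<chi> i j. c * A $ i $ j)"

global_interpretation matsp: vector_space "mscale :: 'k::field \<Rightarrow> 'k^'n^'m \<Rightarrow> 'k^'n^'m"
  by standard (simp_all add: mscale_def vec_eq_iff algebra_simps)

definition fscale :: "'k::field \<Rightarrow> ('a \<Rightarrow> 'k) \<Rightarrow> ('a \<Rightarrow> 'k)"
  where "fscale c f = (\<lambda>x. c * f x)"

global_interpretation funsp: vector_space "fscale :: 'k::field \<Rightarrow> ('a \<Rightarrow> 'k) \<Rightarrow> ('a \<Rightarrow> 'k)"
  by standard (simp_all add: fscale_def fun_eq_iff algebra_simps)


section \<open>Algebras of polynomial functions\<close>

text \<open>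
  Functions on a set \<open>D\<close> are represented by functions on the ambient type that vanish outside
  \<open>D\<close>, so that equality of the representatives is equality on \<open>D\<close> and the ring operations are the
  pointwise ones. The ground fields are infinite, so polynomials are identified with polynomial
  functions.
\<close>

definition const_on :: "'a set \<Rightarrow> 'k::zero \<Rightarrow> 'a \<Rightarrow> 'k"
  where "const_on D c = (\<lambda>x. if x \<in> D then c else 0)"

inductive_set generated_algebra :: "'a set \<Rightarrow> ('a \<Rightarrow> 'k::comm_ring_1) set \<Rightarrow> ('a \<Rightarrow> 'k) set"
  for D :: "'a set" and G :: "('a \<Rightarrow> 'k) set" where
  const: "const_on D c \<in> generated_algebra D G"
| gen: "f \<in> G \<Longrightarrow> f \<in> generated_algebra D G"
| add: "f \<in> generated_algebra D G \<Longrightarrow> g \<in> generated_algebra D G \<Longrightarrow> f + g \<in> generated_algebra D G"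
| mult: "f \<in> generated_algebra D G \<Longrightarrow> g \<in> generated_algebra D G \<Longrightarrow> f * g \<in> generated_algebra D G"

text \<open>The polynomial in one variable that induces a given polynomial function of \<open>t\<close>.\<close>

definition as_poly :: "('k::field \<Rightarrow> 'k) \<Rightarrow> 'k poly"
  where "as_poly h = (THE p. \<forall>t. poly p t = h t)"


section \<open>Zariski topology\<close>

definition zero_locus :: "'a set \<Rightarrow> ('a \<Rightarrow> 'k::zero) set \<Rightarrow> 'a set"
  where "zero_locus D F = {x \<in> D. \<forall>f\<in>F. f x = 0}"

definition zariski :: "'a set \<Rightarrow> ('a \<Rightarrow> 'k::field) set \<Rightarrow> 'a topology"
  where "zariski D A = topology (\<lambda>U. \<exists>F\<subseteq>A. U = D - zero_locus D F)"

lemma istopology_zariski: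
  "istopology (\<lambda>U. \<exists>F\<subseteq>generated_algebra D G. U = D - zero_locus D (F :: ('a \<Rightarrow> 'k::field) set))"
proof -
  let ?A = "generated_algebra D G"
  have "\<exists>F\<subseteq>?A. (D - zero_locus D F1) \<inter> (D - zero_locus D F2) = D - zero_locus D F"
    if "F1 \<subseteq> ?A" "F2 \<subseteq> ?A" for F1 F2
  proof (intro exI conjI)
    show "(\<lambda>(f, g). f * g) ` (F1 \<times> F2) \<subseteq> ?A"
      using that by (auto intro: generated_algebra.mult)
    show "(D - zero_locus D F1) \<inter> (D - zero_locus D F2)
        = D - zero_locus D ((\<lambda>(f, g). f * g) ` (F1 \<times> F2))"
      by (auto simp: zero_locus_def)
  qed
  moreover have "\<exists>F\<subseteq>?A. \<Union>\<K> = D - zero_locus D F"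
    if "\<forall>K\<in>\<K>. \<exists>F\<subseteq>?A. K = D - zero_locus D F" for \<K>
  proof -
    from that obtain F where F: "\<And>K. K \<in> \<K> \<Longrightarrow> F K \<subseteq> ?A \<and> K = D - zero_locus D (F K)"
      by metis
    have "\<Union>\<K> = (\<Union>K\<in>\<K>. D - zero_locus D (F K))"
      using F by (metis (no_types, lifting) SUP_cong image_ident)
    also have "\<dots> = D - zero_locus D (\<Union>K\<in>\<K>. F K)"
      by (auto simp: zero_locus_def)
    finally show ?thesis
      using F by (metis UN_least)
  qed
  ultimately show ?thesis
    unfolding istopology_def by auto
qed

lemma closedin_zariski:
  "closedin (zariski D (generated_algebra D G)) Z
    \<longleftrightarrow> (\<exists>F\<subseteq>generated_algebra D G. Z = zero_locus D (F :: ('a \<Rightarrow> 'k::field) set))"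
proof -
  let ?A = "generated_algebra D G" and ?T = "zariski D (generated_algebra D G)"
  have op: "openin ?T U \<longleftrightarrow> (\<exists>F\<subseteq>?A. U = D - zero_locus D F)" for U
    unfolding zariski_def by (simp add: topology_inverse'[OF istopology_zariski])
  have "openin ?T D"
    unfolding op by (rule exI[of _ "{const_on D 1}"])
      (use generated_algebra.const[of D 1 G] in \<open>auto simp: zero_locus_def const_on_def\<close>)
  moreover have "U \<subseteq> D" if "openin ?T U" for U
    using that unfolding op by auto
  ultimately have "topspace ?T = D"
    by (metis openin_subset openin_topspace subset_antisym)
  moreover have "zero_locus D F \<subseteq> D" for F :: "('a \<Rightarrow> 'k) set"
    by (auto simp: zero_locus_def)
  ultimately show ?thesis
    unfolding closedin_def op by (metis Diff_Diff_Int inf.absorb_iff2)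
qed

definition irreducible_closedin :: "'a topology \<Rightarrow> 'a set \<Rightarrow> bool"
  where "irreducible_closedin T Z \<longleftrightarrow> closedin T Z \<and> Z \<noteq> {} \<and>
    (\<forall>A B. closedin T A \<longrightarrow> closedin T B \<longrightarrow> Z = A \<union> B \<longrightarrow> Z = A \<or> Z = B)"

text \<open>
  The codimension of a closed set \<open>Y\<close>; the infimum over all irreducible closed subsets of \<open>Y\<close> is
  attained at an irreducible component, and it is \<open>\<infinity>\<close> for the empty set.
\<close>

definition codim :: "'a topology \<Rightarrow> 'a set \<Rightarrow> enat"
  where "codim T Y = (INF Z\<in>{Z. irreducible_closedin T Z \<and> Z \<subseteq> Y}.
    SUP n\<in>{n. \<exists>C. C 0 = Z \<and> (\<forall>i\<le>n. irreducible_closedin T (C i)) \<and> (\<forall>i<n. C i \<subset> C (Suc i))}.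
      enat n)"


section \<open>Transcendence degree\<close>

text \<open>The fraction \<open>a / b\<close> over an integral domain, as a class of pairs (numerator, denominator).\<close>

definition fraction :: "('a, 'b) ring_scheme \<Rightarrow> 'a \<Rightarrow> 'a \<Rightarrow> ('a \<times> 'a) set"
  where "fraction R a b =
    {(c, d). c \<in> carrier R \<and> d \<in> carrier R - {\<zero>\<^bsub>R\<^esub>} \<and> a \<otimes>\<^bsub>R\<^esub> d = c \<otimes>\<^bsub>R\<^esub> b}"

definition quotient_field :: "('a, 'b) ring_scheme \<Rightarrow> ('a \<times> 'a) set ring"
  where "quotient_field R =
    \<lparr> carrier = {fraction R a b | a b. a \<in> carrier R \<and> b \<in> carrier R - {\<zero>\<^bsub>R\<^esub>}},
      monoid.mult = (\<lambda>U V. \<Union>(a, b)\<in>U. \<Union>(c, d)\<in>V. fraction R (a \<otimes>\<^bsub>R\<^esub> c) (b \<otimes>\<^bsub>R\<^esub> d)),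
      monoid.one = fraction R \<one>\<^bsub>R\<^esub> \<one>\<^bsub>R\<^esub>,
      ring.zero = fraction R \<zero>\<^bsub>R\<^esub> \<one>\<^bsub>R\<^esub>,
      ring.add = (\<lambda>U V. \<Union>(a, b)\<in>U. \<Union>(c, d)\<in>V.
        fraction R ((a \<otimes>\<^bsub>R\<^esub> d) \<oplus>\<^bsub>R\<^esub> (c \<otimes>\<^bsub>R\<^esub> b)) (b \<otimes>\<^bsub>R\<^esub> d)) \<rparr>"

definition transcendence_basis :: "('a, 'b) ring_scheme \<Rightarrow> 'a set \<Rightarrow> 'a set \<Rightarrow> bool"
  where "transcendence_basis F K B \<longleftrightarrow> B \<subseteq> carrier F \<and>
    (\<forall>b\<in>B. ring.transcendental F (generate_field F (K \<union> (B - {b}))) b) \<and>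
    (\<forall>x\<in>carrier F. ring.algebraic F (generate_field F (K \<union> B)) x)"

definition field_trdeg :: "('a, 'b) ring_scheme \<Rightarrow> 'a set \<Rightarrow> nat"
  where "field_trdeg F K = (LEAST n. \<exists>B. finite B \<and> card B = n \<and> transcendence_basis F K B)"

definition function_ring :: "'a set \<Rightarrow> ('a \<Rightarrow> 'k::comm_ring_1) set \<Rightarrow> ('a \<Rightarrow> 'k) ring"
  where "function_ring D A =
    \<lparr> carrier = A, monoid.mult = (*), monoid.one = const_on D 1, ring.zero = 0, ring.add = (+) \<rparr>"

text \<open>
  For a subalgebra \<open>A\<close> (with unit, without zero divisors) of the functions on \<open>D\<close>. The least
  cardinality above is only meaningful when it is finite, which holds for all subalgebras of
  polynomial algebras in finitely many variables.
\<close>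

definition trdeg :: "'a set \<Rightarrow> ('a \<Rightarrow> 'k::comm_ring_1) set \<Rightarrow> nat"
  where "trdeg D A = (let R = function_ring D A in
    field_trdeg (quotient_field R) (range (\<lambda>c. fraction R (const_on D c) (const_on D 1))))"


section \<open>Algebraic groups and their Lie algebras\<close>

definition matrix_polys :: "('k::field^'n^'n \<Rightarrow> 'k) set"
  where "matrix_polys = generated_algebra UNIV {\<lambda>A. A $ i $ j | i j. True}"

definition matrix_zariski :: "('k::field^'n^'n) topology"
  where "matrix_zariski = zariski UNIV matrix_polys"

text \<open>Affine algebraic groups are realised as Zariski closed subgroups of a general linear group.\<close>

definition algebraic_group :: "('k::field^'n^'n) set \<Rightarrow> bool"
  where "algebraic_group Q \<longleftrightarrow>
    closedin (subtopology matrix_zariski {A. invertible A}) Q \<and>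
    mat 1 \<in> Q \<and> (\<forall>A\<in>Q. \<forall>B\<in>Q. A ** B \<in> Q) \<and> (\<forall>A\<in>Q. matrix_inv A \<in> Q)"

definition connected_algebraic_group :: "('k::field^'n^'n) set \<Rightarrow> bool"
  where "connected_algebraic_group Q \<longleftrightarrow>
    algebraic_group Q \<and> connected_space (subtopology matrix_zariski Q)"

definition lie_bracket :: "'k::field^'n^'n \<Rightarrow> 'k^'n^'n \<Rightarrow> 'k^'n^'n"
  where "lie_bracket x y = x ** y - y ** x"

text \<open>The tangent space at the identity, with the commutator as Lie bracket.\<close>

definition lie_algebra :: "('k::field^'n^'n) set \<Rightarrow> ('k^'n^'n) set"
  where "lie_algebra Q = {x. \<forall>f\<in>matrix_polys. (\<forall>A\<in>Q. f A = 0) \<longrightarrow>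
    Polynomial.coeff (as_poly (\<lambda>t. f (mat 1 + mscale t x))) 1 = 0}"


section \<open>The dual space, index and regular elements\<close>

text \<open>Linear forms on the subspace \<open>q\<close>, extended by zero outside \<open>q\<close>.\<close>

definition dual_space :: "('k::field^'n^'n) set \<Rightarrow> ('k^'n^'n \<Rightarrow> 'k) set"
  where "dual_space q = {\<xi>. (\<forall>x\<in>q. \<forall>y\<in>q. \<xi> (x + y) = \<xi> x + \<xi> y) \<and>
    (\<forall>c. \<forall>x\<in>q. \<xi> (mscale c x) = c * \<xi> x) \<and> (\<forall>x. x \<notin> q \<longrightarrow> \<xi> x = 0)}"

definition stabiliser :: "('k::field^'n^'n) set \<Rightarrow> ('k^'n^'n \<Rightarrow> 'k) \<Rightarrow> ('k^'n^'n) set"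
  where "stabiliser q \<xi> = {x \<in> q. \<forall>y\<in>q. \<xi> (lie_bracket x y) = 0}"

definition ind :: "('k::field^'n^'n) set \<Rightarrow> nat"
  where "ind q = (INF \<xi>\<in>dual_space q. matsp.dim (stabiliser q \<xi>))"

definition b_invariant :: "('k::field^'n^'n) set \<Rightarrow> real"
  where "b_invariant q = (real (matsp.dim q) + real (ind q)) / 2"

definition regular_set :: "('k::field^'n^'n) set \<Rightarrow> ('k^'n^'n \<Rightarrow> 'k) set"
  where "regular_set q = {\<xi> \<in> dual_space q. matsp.dim (stabiliser q \<xi>) = ind q}"


section \<open>The symmetric algebra and its Poisson structure\<close>

definition evaluation :: "('k::field^'n^'n) set \<Rightarrow> 'k^'n^'n \<Rightarrow> ('k^'n^'n \<Rightarrow> 'k) \<Rightarrow> 'k"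
  where "evaluation q x = (\<lambda>\<xi>. if \<xi> \<in> dual_space q then \<xi> x else 0)"

definition symmetric_algebra :: "('k::field^'n^'n) set \<Rightarrow> (('k^'n^'n \<Rightarrow> 'k) \<Rightarrow> 'k) set"
  where "symmetric_algebra q = generated_algebra (dual_space q) (evaluation q ` q)"

definition codim_property :: "nat \<Rightarrow> ('k::field^'n^'n) set \<Rightarrow> bool"
  where "codim_property n q \<longleftrightarrow>
    codim (zariski (dual_space q) (symmetric_algebra q)) (dual_space q - regular_set q) \<ge> enat n"

text \<open>\<open>degree_le q d f\<close>: \<open>f\<close> is a polynomial function on the dual space of \<open>q\<close>, of degree at most \<open>d\<close>.\<close>

inductive degree_le :: "('k::field^'n^'n) set \<Rightarrow> nat \<Rightarrow> (('k^'n^'n \<Rightarrow> 'k) \<Rightarrow> 'k) \<Rightarrow> bool"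
  for q :: "('k^'n^'n) set" where
  const: "degree_le q 0 (const_on (dual_space q) c)"
| linear: "x \<in> q \<Longrightarrow> degree_le q 1 (evaluation q x)"
| mono: "degree_le q d f \<Longrightarrow> d \<le> e \<Longrightarrow> degree_le q e f"
| add: "degree_le q d f \<Longrightarrow> degree_le q d g \<Longrightarrow> degree_le q d (f + g)"
| mult: "degree_le q d f \<Longrightarrow> degree_le q e g \<Longrightarrow> degree_le q (d + e) (f * g)"

definition poly_degree :: "('k::field^'n^'n) set \<Rightarrow> (('k^'n^'n \<Rightarrow> 'k) \<Rightarrow> 'k) \<Rightarrow> nat"
  where "poly_degree q f = (LEAST d. degree_le q d f)"

definition differential ::
    "('k::field^'n^'n) set \<Rightarrow> (('k^'n^'n \<Rightarrow> 'k) \<Rightarrow> 'k) \<Rightarrow> ('k^'n^'n \<Rightarrow> 'k) \<Rightarrow> 'k^'n^'n"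
  where "differential q f \<eta> = (THE x. x \<in> q \<and>
    (\<forall>\<nu>\<in>dual_space q. \<nu> x = Polynomial.coeff (as_poly (\<lambda>t. f (\<eta> + fscale t \<nu>))) 1))"

definition poisson_bracket ::
    "('k::field^'n^'n) set \<Rightarrow> (('k^'n^'n \<Rightarrow> 'k) \<Rightarrow> 'k) \<Rightarrow> (('k^'n^'n \<Rightarrow> 'k) \<Rightarrow> 'k)
      \<Rightarrow> (('k^'n^'n \<Rightarrow> 'k) \<Rightarrow> 'k)"
  where "poisson_bracket q f g = (\<lambda>\<eta>. if \<eta> \<in> dual_space q
    then \<eta> (lie_bracket (differential q f \<eta>) (differential q g \<eta>)) else 0)"

definition poisson_centre :: "('k::field^'n^'n) set \<Rightarrow> (('k^'n^'n \<Rightarrow> 'k) \<Rightarrow> 'k) set"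
  where "poisson_centre q =
    {f \<in> symmetric_algebra q. \<forall>g\<in>symmetric_algebra q. poisson_bracket q f g = 0}"


section \<open>Argument shift\<close>

definition shift :: "('k::field^'n^'n) set \<Rightarrow> ('k^'n^'n \<Rightarrow> 'k) \<Rightarrow> (('k^'n^'n \<Rightarrow> 'k) \<Rightarrow> 'k) \<Rightarrow> nat
      \<Rightarrow> (('k^'n^'n \<Rightarrow> 'k) \<Rightarrow> 'k)"
  where "shift q \<xi> f j = (\<lambda>\<mu>. if \<mu> \<in> dual_space q
    then Polynomial.coeff (as_poly (\<lambda>a. f (\<mu> + fscale a \<xi>))) j else 0)"

definition shift_algebra :: "('k::field^'n^'n) set \<Rightarrow> ('k^'n^'n \<Rightarrow> 'k)
      \<Rightarrow> (('k^'n^'n \<Rightarrow> 'k) \<Rightarrow> 'k) set \<Rightarrow> (('k^'n^'n \<Rightarrow> 'k) \<Rightarrow> 'k) set"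
  where "shift_algebra q \<xi> A = generated_algebra (dual_space q)
    {shift q \<xi> f j | f j. f \<in> A \<and> j < poly_degree q f}"

end

theory Submission
  imports Defs
begin

text \<open>
  The forms \<open>(x, y) \<mapsto> \<langle>\<gamma>, [x, y]\<rangle>\<close> for \<open>\<gamma> \<in> P\<close> make up a pencil of skew forms on \<open>\<qq>\<close> whose non-zero
  members all have a kernel of dimension \<open>ind \<qq>\<close>; the kernel for \<open>\<gamma>\<close> is the stabiliser \<open>\<qq>\<^sub>\<gamma>\<close>. The
  differentials of the Poisson centre at \<open>\<gamma>\<close> lie in \<open>\<qq>\<^sub>\<gamma>\<close>. Since they span a space of full dimension
  at \<open>\<xi>0\<close> and the centre is stable under dilations, they span \<open>\<qq>\<^sub>\<gamma>\<close> for
  \<open>\<gamma> = \<eta> + a \<xi>\<close> with all but finitely many \<open>a\<close>. Expanding the differential of \<open>f\<close> at \<open>\<eta> + a \<xi>\<close> in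
  powers of \<open>a\<close> gives the differentials at \<open>\<eta>\<close> of the \<open>\<xi>\<close>-shifts, so by interpolation the latter span
  the sum of these stabilisers, where any finite set of values \<open>a\<close> may be omitted. Linear algebra
  of pencils shows that this sum has dimension \<open>(dim \<qq> + ind \<qq>) / 2\<close>.
\<close>

section \<open>Pencils of skew forms\<close>

text \<open>Behind the dimension formula stands the Kronecker normal form: a skew pencil of constant
  rank over an algebraically closed field has no Jordan part, and a block of size 2k+1 carries one
  kernel line per parameter, these lines spanning k+1 dimensions; summing over r blocks gives (dim +
  r)/2. The normal form is never constructed: the sum of kernels is shown to be its own orthogonal
  space instead. The freedom to omit parameters serves twice there. The good values a are only known
  to form a cofinite set, and dropping one further value keeps factors such as a - b or t - s b away
  from zero. Regularity of the whole punctured plane is what excludes a Jordan part: every member,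
  including the one belonging to \<xi> itself, must have a kernel of dimension r. Dilations enter
  because \<xi>0 lies in P but usually not on the affine line \<eta> + a \<xi>; rescaling moves it
  there, which is possible exactly off the multiples of \<xi>.\<close>

definition (in vector_space) functional :: "('b \<Rightarrow> 'a) \<Rightarrow> bool"
  where "functional \<phi> \<longleftrightarrow> Vector_Spaces.linear scale (*) \<phi>"

definition (in vector_space) bilinear_form :: "('b \<Rightarrow> 'b \<Rightarrow> 'a) \<Rightarrow> bool"
  where "bilinear_form C \<longleftrightarrow> (\<forall>x. functional (C x)) \<and> (\<forall>y. functional (\<lambda>x. C x y))"

context vector_space
begin

lemma functional_iff:
  "functional \<phi> \<longleftrightarrow> (\<forall>x y. \<phi> (x + y) = \<phi> x + \<phi> y) \<and> (\<forall>c x. \<phi> (scale c x) = c * \<phi> x)"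
  unfolding functional_def Vector_Spaces.linear_iff
  using vector_space_over_itself.vector_space_axioms vector_space_axioms by blast

lemma functional_simps:
  assumes "functional \<phi>"
  shows "\<phi> (x + y) = \<phi> x + \<phi> y" "\<phi> (scale c x) = c * \<phi> x" "\<phi> 0 = 0"
    "\<phi> (- x) = - \<phi> x" "\<phi> (x - y) = \<phi> x - \<phi> y" "\<phi> (sum f I) = (\<Sum>i\<in>I. \<phi> (f i))"
proof -
  interpret Vector_Spaces.linear scale "(*)" \<phi>
    using assms by (simp add: functional_def)
  show "\<phi> (x + y) = \<phi> x + \<phi> y" "\<phi> (scale c x) = c * \<phi> x" "\<phi> 0 = 0"
    "\<phi> (- x) = - \<phi> x" "\<phi> (x - y) = \<phi> x - \<phi> y" "\<phi> (sum f I) = (\<Sum>i\<in>I. \<phi> (f i))"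
    by (simp_all add: add scale neg diff sum)
qed

lemma functional_comb:
  "functional \<phi> \<Longrightarrow> functional \<psi> \<Longrightarrow> functional (\<lambda>x. s * \<phi> x + t * \<psi> x)"
  by (auto simp: functional_iff algebra_simps)

lemma bilinear_form_comb:
  "bilinear_form A \<Longrightarrow> bilinear_form B \<Longrightarrow> bilinear_form (\<lambda>x y. s * A x y + t * B x y)"
  unfolding bilinear_form_def using functional_comb by auto

lemma bilinear_form_flip: "bilinear_form C \<Longrightarrow> bilinear_form (\<lambda>x y. C y x)"
  by (auto simp: bilinear_form_def)

lemma bilinear_formD:
  assumes "bilinear_form C"
  shows "functional (C x)" "functional (\<lambda>x. C x y)"
  using assms by (auto simp: bilinear_form_def)

lemma functional_zero_on_span:
  assumes "functional \<phi>" "x \<in> span S" "\<And>x. x \<in> S \<Longrightarrow> \<phi> x = 0"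
  shows "\<phi> x = 0"
  using assms(2)
proof (induction rule: span_induct_alt)
  case base show ?case using functional_simps(3)[OF assms(1)] .
next
  case (step c x y) then show ?case
    using assms(3) by (simp add: functional_simps[OF assms(1)])
qed

lemma separating_functional:
  assumes "x \<notin> span S"
  obtains \<phi> where "functional \<phi>" "\<And>y. y \<in> span S \<Longrightarrow> \<phi> y = 0" "\<phi> x = 1"
proof -
  interpret vector_space_pair scale "(*)"
    by (intro vector_space_pair.intro vector_space_axioms vector_space_over_itself.vector_space_axioms)
  obtain B where B: "B \<subseteq> span S" "independent B" "span S \<subseteq> span B"
    using maximal_independent_subset by blast
  have spB: "span B = span S"
    using B by (simp add: span_minimal subset_antisym)
  have "independent (insert x B)"
    using B(2) assms spB by (simp add: independent_insertI)
  then obtain \<phi> where \<phi>: "Vector_Spaces.linear scale (*) \<phi>"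
      "\<forall>y\<in>insert x B. \<phi> y = (if y = x then 1 else 0)"
    using linear_independent_extend[of "insert x B" "\<lambda>y. if y = x then 1 else 0"] by blast
  have f: "functional \<phi>" using \<phi> by (simp add: functional_def)
  have "\<phi> y = 0" if "y \<in> span S" for y
    using functional_zero_on_span[OF f, of y B] that spB \<phi>(2) assms B(1)
    by (metis insertCI subset_iff)
  then show thesis using that f \<phi>(2) by auto
qed

text \<open>Elements of the dual space of a matrix subspace are linear on that subspace only, while
  the forms of this section are linear on the whole space; interpolating on a basis of
  \<open>U\<close> passes from one to the other.\<close>

lemma extend_functional:
  assumes "subspace U" "\<And>x y. x \<in> U \<Longrightarrow> y \<in> U \<Longrightarrow> \<nu> (x + y) = \<nu> x + \<nu> y"
    "\<And>c x. x \<in> U \<Longrightarrow> \<nu> (scale c x) = c * \<nu> x"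
  obtains \<phi> where "functional \<phi>" "\<And>x. x \<in> U \<Longrightarrow> \<phi> x = \<nu> x"
proof -
  interpret vector_space_pair scale "(*)"
    by (intro vector_space_pair.intro vector_space_axioms vector_space_over_itself.vector_space_axioms)
  obtain B where B: "B \<subseteq> U" "independent B" "U \<subseteq> span B"
    using maximal_independent_subset by blast
  obtain \<phi> where \<phi>: "Vector_Spaces.linear scale (*) \<phi>" "\<forall>y\<in>B. \<phi> y = \<nu> y"
    using linear_independent_extend[of B \<nu>] B by blast
  have f: "functional \<phi>" using \<phi> by (simp add: functional_def)
  have "x \<in> U \<and> \<phi> x = \<nu> x" if "x \<in> span B" for x
    using that
  proof (induction rule: span_induct_alt)
    case base
    have "\<nu> 0 = 0" using assms(3)[of 0 0] assms(1) by (simp add: subspace_0)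
    then show ?case using functional_simps(3)[OF f] assms(1) by (simp add: subspace_0)
  next
    case (step c x y)
    then have "x \<in> U" "scale c x \<in> U" using B(1) assms(1) by (auto intro: subspace_scale)
    then show ?case using step \<phi>(2) assms by (auto simp: functional_simps[OF f] subspace_add)
  qed
  then show thesis using that f B(3) by blast
qed

end

section \<open>Dimension counts for orthogonal spaces of a bilinear form\<close>

context finite_dimensional_vector_space
begin

lemma subspace_functional_kernel:
  assumes "subspace U" "\<And>b. b \<in> B \<Longrightarrow> functional (\<phi> b)"
  shows "subspace {x\<in>U. \<forall>b\<in>B. \<phi> b x = 0}"
  using assms(1) unfolding subspace_def
  by (auto simp: functional_simps[OF assms(2)])

lemma dim_functional_kernel:
  assumes "subspace U" "functional \<phi>"
  shows "dim U \<le> dim {x\<in>U. \<phi> x = 0} + 1"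
proof (cases "\<exists>u\<in>U. \<phi> u \<noteq> 0")
  case True
  then obtain u where u: "u \<in> U" "\<phi> u \<noteq> 0" by blast
  let ?K = "{x\<in>U. \<phi> x = 0}"
  have "U \<subseteq> span (insert u ?K)"
  proof
    fix x assume x: "x \<in> U"
    have "x - scale (\<phi> x / \<phi> u) u \<in> span ?K"
      by (rule span_base)
        (use x u assms in \<open>simp add: functional_simps subspace_diff subspace_scale\<close>)
    then show "x \<in> span (insert u ?K)"
      unfolding span_insert by blast
  qed
  then have "dim U \<le> dim (insert u ?K)" by (rule dim_mono)
  also have "\<dots> \<le> dim ?K + 1" by (simp add: dim_insert)
  finally show ?thesis .
next
  case False
  then have "{x\<in>U. \<phi> x = 0} = U" by auto
  then show ?thesis by simp
qed

lemma dim_functionals_kernel: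
  assumes "finite B" "subspace U" "\<And>b. b \<in> B \<Longrightarrow> functional (\<phi> b)"
  shows "dim U \<le> dim {x\<in>U. \<forall>b\<in>B. \<phi> b x = 0} + card B"
  using assms(1,3)
proof (induction B)
  case empty then show ?case by simp
next
  case (insert b B)
  let ?K = "{x\<in>U. \<forall>b\<in>B. \<phi> b x = 0}"
  have "subspace ?K" using subspace_functional_kernel[OF assms(2)] insert by blast
  then have "dim ?K \<le> dim {x\<in>?K. \<phi> b x = 0} + 1"
    using dim_functional_kernel insert by blast
  moreover have "{x\<in>?K. \<phi> b x = 0} = {x\<in>U. \<forall>b\<in>insert b B. \<phi> b x = 0}" by auto
  ultimately show ?case using insert by auto
qed

lemma span_Int_span_independent:
  assumes "independent (S \<union> T)" "S \<inter> T = {}"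
  shows "span S \<inter> span T = {0}"
proof -
  have ind: "independent S" "independent T"
    using assms(1) independent_mono by blast+
  have fin: "finite S" "finite T"
    using ind finiteI_independent by blast+
  have "dim (span (S \<union> T)) + dim (span S \<inter> span T) = dim (span S) + dim (span T)"
    unfolding span_Un using dim_sums_Int[OF subspace_span subspace_span] by simp
  then have "dim (span S \<inter> span T) = 0"
    using card_Un_disjoint[OF fin assms(2)] dim_eq_card_independent[OF assms(1)]
      dim_eq_card_independent[OF ind(1)] dim_eq_card_independent[OF ind(2)]
    unfolding dim_span by linarith
  then show ?thesis
    using span_zero by auto
qed

text \<open>Extend a basis \<open>B0\<close> of the left kernel to a basis \<open>B\<close> of
  \<open>U\<close>. The vectors of \<open>B0\<close> impose no condition on \<open>V\<close>, so the
  right orthogonal space is cut out by only \<open>dim U - dim ?K\<close> functionals.\<close>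

lemma dim_orthogonal_ge:
  assumes U: "subspace U" and V: "subspace V" and C: "bilinear_form C"
  shows "dim V + dim {x\<in>U. \<forall>y\<in>V. C x y = 0} \<le> dim {y\<in>V. \<forall>x\<in>U. C x y = 0} + dim U"
proof -
  let ?K = "{x\<in>U. \<forall>y\<in>V. C x y = 0}"
  obtain B0 where B0: "B0 \<subseteq> ?K" "independent B0" "?K \<subseteq> span B0" "card B0 = dim ?K"
    using basis_exists by blast
  have "B0 \<subseteq> U" using B0 by auto
  then obtain B where B: "B0 \<subseteq> B" "B \<subseteq> U" "independent B" "U \<subseteq> span B"
    using maximal_independent_subset_extend[of B0 U] B0 by blast
  have fin: "finite B" by (rule finiteI_independent[OF B(3)])
  have cB: "card B = dim U" by (rule basis_card_eq_dim[OF B(2,4,3)])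
  have "dim V \<le> dim {y\<in>V. \<forall>x\<in>B-B0. C x y = 0} + card (B - B0)"
    by (rule dim_functionals_kernel[where \<phi> = C, OF finite_Diff[OF fin] V bilinear_formD(1)[OF C]])
  also have "{y\<in>V. \<forall>x\<in>B-B0. C x y = 0} = {y\<in>V. \<forall>x\<in>U. C x y = 0}"
  proof -
    have "C x y = 0" if y: "y \<in> V" "\<forall>x\<in>B-B0. C x y = 0" and x: "x \<in> U" for x y
    proof (rule functional_zero_on_span[of "\<lambda>x. C x y" x B])
      show "functional (\<lambda>x. C x y)" by (rule bilinear_formD(2)[OF C])
      show "x \<in> span B" using x B(4) by blast
      show "C z y = 0" if "z \<in> B" for z
        using that y B0(1) by (cases "z \<in> B0") blast+
    qed
    then show ?thesis using B(2) by blast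
  qed
  also have "card (B - B0) = dim U - dim ?K"
    using card_Diff_subset[of B0 B] B(1) B0(4) cB finite_subset[OF B(1) fin] by simp
  finally show ?thesis using dim_subset[of ?K U] by simp
qed

text \<open>Row rank equals column rank for the pairing of \<open>U\<close> and \<open>V\<close>:
  the one-sided estimate is applied to the form and to its flip.\<close>

lemma dim_orthogonal:
  assumes "subspace U" "subspace V" "bilinear_form C"
  shows "dim V + dim {x\<in>U. \<forall>y\<in>V. C x y = 0} = dim {y\<in>V. \<forall>x\<in>U. C x y = 0} + dim U"
  using dim_orthogonal_ge[OF assms] dim_orthogonal_ge[OF assms(2,1) bilinear_form_flip[OF assms(3)]]
  by linarith

end

section \<open>Pencils over an algebraically closed field\<close>

locale alg_closed_vector_space = finite_dimensional_vector_space scale Basis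
  for scale :: "'k::alg_closed_field \<Rightarrow> 'v::ab_group_add \<Rightarrow> 'v" and Basis
begin

text \<open>No determinants: among the non-zero polynomials p with p(T) w = 0 for some non-zero w in
  \<open>W\<close>, take one of least degree. For a root l, write p = (X - l) q; then q(T) w is
  non-zero by minimality, and T - l kills it.\<close>

lemma eigenvector_exists:
  assumes T: "Vector_Spaces.linear scale scale T" and W: "subspace W" "W \<noteq> {0}"
    and inv: "\<And>x. x \<in> W \<Longrightarrow> T x \<in> W"
  obtains l w where "w \<in> W" "w \<noteq> 0" "T w = scale l w"
proof -
  interpret T: Vector_Spaces.linear scale scale T by (rule T)
  \<comment> \<open>\<open>act p w\<close> is \<open>p(T) w\<close>\<close>
  define act where "act p w = fold_coeffs (\<lambda>a v. scale a w + T v) p 0" for p w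
  have act_0: "act 0 w = 0" for w by (simp add: act_def)
  have act_pCons: "act (pCons a p) w = scale a w + T (act p w)" for a p w
    by (cases "p = 0 \<and> a = 0") (auto simp: act_def T.zero)
  have act_add: "act (p + q) w = act p w + act q w" for p q w
    by (induction p q rule: poly_induct2)
      (auto simp: act_0 act_pCons T.add scale_left_distrib)
  have act_smult: "act (Polynomial.smult c p) w = scale c (act p w)" for c p w
    by (induction p) (auto simp: act_0 act_pCons T.scale scale_right_distrib)
  have act_sum: "act (sum f I) w = (\<Sum>i\<in>I. act (f i) w)" for f I w
    by (induction I rule: infinite_finite_induct) (auto simp: act_0 act_add)
  have act_monom: "act (Polynomial.monom c i) w = scale c ((T ^^ i) w)" for c i w
    by (induction i) (auto simp: monom_0 monom_Suc act_0 act_pCons T.zero T.scale)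
  have act_W: "act p w \<in> W" if "w \<in> W" for p w
    using that W(1) inv
    by (induction p) (auto simp: act_0 act_pCons subspace_0 subspace_add subspace_scale)
  obtain w0 where w0: "w0 \<in> W" "w0 \<noteq> 0"
    using W subspace_0 by blast
  have ex: "\<exists>p. p \<noteq> 0 \<and> act p w0 = 0"
  \<comment> \<open>Dependence is a property of a set, so a repetition among the iterates has to be
    treated apart: it yields X^i - X^j. Without repetition, \<open>dim W + 1\<close> distinct
    vectors of \<open>W\<close> are dependent.\<close>
  proof (cases "inj_on (\<lambda>i. (T ^^ i) w0) {..dim W}")
    case False
    then obtain i j where ij: "i \<noteq> j" "(T ^^ i) w0 = (T ^^ j) w0"
      by (auto simp: inj_on_def)
    let ?p = "Polynomial.monom 1 i + Polynomial.smult (-1) (Polynomial.monom 1 j) :: 'k poly"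
    have "Polynomial.coeff ?p i = 1" using ij by simp
    then have "?p \<noteq> 0" by (metis Polynomial.coeff_0 zero_neq_one)
    moreover have "act ?p w0 = 0" using ij by (simp only: act_add act_smult act_monom) simp
    ultimately show ?thesis by blast
  next
    case True
    let ?Bs = "(\<lambda>i. (T ^^ i) w0) ` {..dim W}"
    have "(T ^^ i) w0 \<in> W" for i using w0 inv by (induction i) auto
    then have "?Bs \<subseteq> W" by auto
    moreover have "card ?Bs = Suc (dim W)" using card_image[OF True] by simp
    ultimately have "dependent ?Bs"
      using independent_card_le_dim[of ?Bs W] by auto
    then obtain u v where uv: "v \<in> ?Bs" "u v \<noteq> 0" "(\<Sum>v\<in>?Bs. scale (u v) v) = 0"
      by (auto simp: dependent_finite)
    let ?p = "\<Sum>i\<le>dim W. Polynomial.monom (u ((T ^^ i) w0)) i"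
    obtain i where i: "i \<le> dim W" "v = (T ^^ i) w0" using uv by auto
    have "Polynomial.coeff ?p i = u v" using i by (simp add: Polynomial.coeff_sum)
    then have "?p \<noteq> 0" using uv by (metis Polynomial.coeff_0)
    moreover have "act ?p w0 = 0"
      using uv(3) unfolding sum.reindex[OF True] by (simp add: act_sum act_monom)
    ultimately show ?thesis by blast
  qed
  define P where "P p \<longleftrightarrow> p \<noteq> 0 \<and> (\<exists>w\<in>W. w \<noteq> 0 \<and> act p w = 0)" for p
  have "\<exists>p. P p" using ex w0 by (auto simp: P_def)
  then obtain p where p: "P p" and min: "\<And>q. P q \<Longrightarrow> Polynomial.degree p \<le> Polynomial.degree q"
    using ex_has_least_nat[of P _ Polynomial.degree] by blast
  obtain w where w: "w \<in> W" "w \<noteq> 0" "act p w = 0" and p0: "p \<noteq> 0" using p by (auto simp: P_def)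
  have "Polynomial.degree p > 0"
  proof (rule ccontr)
    assume "\<not> Polynomial.degree p > 0"
    then obtain c where c: "p = [:c:]" using degree_eq_zeroE by blast
    then show False using w p0 by (simp add: act_pCons act_0 T.zero)
  qed
  then obtain l where "poly p l = 0" using alg_closed_imp_poly_has_root by blast
  then obtain q where q: "p = [:-l, 1:] * q" using poly_eq_0_iff_dvd by (metis dvdE)
  then have q0: "q \<noteq> 0" using p0 by auto
  then have "Polynomial.degree p = Suc (Polynomial.degree q)" unfolding q by (subst degree_mult_eq) auto
  then have "\<not> P q" using min by fastforce
  then have nz: "act q w \<noteq> 0" using q0 w by (auto simp: P_def)
  have "p = pCons 0 q + Polynomial.smult (-l) q" using q by simp
  then have "T (act q w) = scale l (act q w)"
    using w(3) by (simp only: act_add act_smult act_pCons) simp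
  then show thesis using that act_W w nz by blast
qed

text \<open>If \<open>B\<close> is degenerate on \<open>W\<close>, it is itself the singular member.
  Otherwise there is an operator \<open>T\<close> on \<open>W\<close>, morally the inverse of
  \<open>B\<close> composed with \<open>A\<close>, such that B (T w) y = A w y for y in
  \<open>W\<close>; an eigenvector of \<open>T\<close> with value l is killed by A - l B.\<close>

lemma singular_pencil_member:
  assumes W: "subspace W" "W \<noteq> {0}" and A: "bilinear_form A" and B: "bilinear_form B"
  obtains s t w where "(s, t) \<noteq> (0, 0)" "w \<in> W" "w \<noteq> 0" "\<And>y. y \<in> W \<Longrightarrow> s * A w y + t * B w y = 0"
proof (cases "\<exists>w\<in>W. w \<noteq> 0 \<and> (\<forall>y\<in>W. B w y = 0)")
  case True
  then show thesis using that[of 0 1] by auto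
next
  case False
  obtain Bs where Bs: "finite Bs" "Bs \<subseteq> W" "independent Bs" "span Bs = W" "card Bs = dim W"
    using basis_subspace_exists[OF W(1)] by blast
  have span0: "\<phi> y = 0" if "functional \<phi>" "\<forall>x\<in>Bs. \<phi> x = 0" "y \<in> W" for \<phi> y
    using functional_zero_on_span[OF that(1), of y Bs] that Bs(4) by auto
  \<comment> \<open>This is the basis dual to \<open>Bs\<close> under \<open>B\<close>: dim W - 1
    conditions leave a non-zero vector, and by nondegeneracy it cannot pair to zero with
    \<open>j\<close> as well.\<close>
  have "\<exists>u\<in>W. B u j = 1 \<and> (\<forall>i\<in>Bs-{j}. B u i = 0)" if j: "j \<in> Bs" for j
  proof -
    let ?K = "{w\<in>W. \<forall>i\<in>Bs-{j}. B w i = 0}"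
    have "dim W \<le> dim ?K + card (Bs - {j})"
      using dim_functionals_kernel[of "Bs - {j}" W "\<lambda>i w. B w i"] Bs W bilinear_formD[OF B] by auto
    moreover have "card (Bs - {j}) < card Bs" using j Bs(1) by (meson card_Diff1_less)
    ultimately have "dim ?K \<noteq> 0" using Bs(5) by linarith
    then obtain u where u: "u \<in> ?K" "u \<noteq> 0" by auto
    have "B u j \<noteq> 0"
    proof
      assume "B u j = 0"
      then have "\<forall>i\<in>Bs. B u i = 0" using u by blast
      then have "\<forall>y\<in>W. B u y = 0" using span0 bilinear_formD[OF B] by blast
      then show False using False u by blast
    qed
    then show ?thesis using u W(1)
      by (intro bexI[of _ "scale (1 / B u j) u"])
        (auto simp: functional_simps(2)[OF bilinear_formD(2)[OF B]] subspace_scale)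
  qed
  then obtain u where u: "\<And>j. j \<in> Bs \<Longrightarrow> u j \<in> W" "\<And>j. j \<in> Bs \<Longrightarrow> B (u j) j = 1"
    "\<And>i j. j \<in> Bs \<Longrightarrow> i \<in> Bs \<Longrightarrow> i \<noteq> j \<Longrightarrow> B (u j) i = 0"
    by (metis DiffI singletonD)
  define T where "T w = (\<Sum>j\<in>Bs. scale (A w j) (u j))" for w
  have "Vector_Spaces.linear scale scale T"
    unfolding Vector_Spaces.linear_iff T_def using vector_space_axioms
    by (simp add: functional_simps(1,2)[OF bilinear_formD(2)[OF A]] sum.distrib
        scale_left_distrib scale_sum_right)
  moreover have "T x \<in> W" for x
    unfolding T_def using u W(1) by (auto intro!: subspace_sum subspace_scale)
  ultimately obtain l w where w: "w \<in> W" "w \<noteq> 0" "T w = scale l w"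
    using eigenvector_exists[OF _ W] by blast
  have "B (T w) i = A w i" if i: "i \<in> Bs" for i
  proof -
    have "B (T w) i = (\<Sum>j\<in>Bs. A w j * B (u j) i)"
      unfolding T_def by (simp add: functional_simps[OF bilinear_formD(2)[OF B]])
    also have "\<dots> = (\<Sum>j\<in>Bs. if j = i then A w j else 0)"
      using u i by (intro sum.cong) auto
    finally show ?thesis using i Bs(1) by simp
  qed
  then have "\<forall>i\<in>Bs. 1 * A w i + (- l) * B w i = 0"
    using w(3) by (simp add: functional_simps(2)[OF bilinear_formD(2)[OF B]])
  then have "1 * A w y + (- l) * B w y = 0" if "y \<in> W" for y
    using span0[OF functional_comb[OF bilinear_formD(1)[OF A] bilinear_formD(1)[OF B]]] that by blast
  then show thesis using that[of 1 "- l" w] w by auto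
qed

text \<open>
  All forms of the pencil have the same orthogonal space \<open>M\<close> of \<open>L\<close>, because \<open>A\<close> and \<open>B\<close> are
  proportional on each generator of \<open>L\<close>. Comparing dimensions, \<open>L\<close> contains the kernel of every form,
  so the orthogonal space of \<open>M\<close> is \<open>L\<close> again. On a complement of \<open>L\<close> in \<open>M\<close> no form
  of the pencil is degenerate, which over an algebraically closed field forces \<open>M = L\<close>.
\<close>

lemma dim_sum_of_pencil_kernels:
  fixes A B :: "'v \<Rightarrow> 'v \<Rightarrow> 'k"
  defines "ker \<equiv> \<lambda>V s t. {x\<in>V. \<forall>y\<in>V. s * A x y + t * B x y = 0}"
  assumes V: "subspace V" and A: "bilinear_form A" and B: "bilinear_form B"
    and skew: "\<And>x y. x \<in> V \<Longrightarrow> y \<in> V \<Longrightarrow> A x y = - A y x"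
      "\<And>x y. x \<in> V \<Longrightarrow> y \<in> V \<Longrightarrow> B x y = - B y x"
    and rank: "\<And>s t. (s, t) \<noteq> (0, 0) \<Longrightarrow> dim (ker V s t) = r"
    and S: "S \<noteq> {}"
    and L: "\<And>c. L = span (\<Union>a\<in>S - {c}. ker V 1 a)"
  shows "2 * dim L = dim V + r"
proof -
  define form where "form s t x y = s * A x y + t * B x y" for s t x y
  have form: "bilinear_form (form s t)" for s t
    unfolding form_def[abs_def] by (rule bilinear_form_comb[OF A B])
  have form_skew: "form s t x y = - form s t y x" if "x \<in> V" "y \<in> V" for s t x y
    using skew[OF that] by (simp add: form_def)
  have ker_eq: "ker V s t = {x\<in>V. \<forall>y\<in>V. form s t x y = 0}" for s t
    by (simp add: ker_def form_def)
  have subL: "subspace L" unfolding L[of 0] by simp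
  have kerV: "ker V s t \<subseteq> V" for s t by (auto simp: ker_eq)
  have LV: "L \<subseteq> V" unfolding L[of 0] by (rule span_minimal[OF _ V]) (use kerV in blast)
  \<comment> \<open>The value \<open>a + 1\<close> is just some parameter other than
    \<open>a\<close>; omitting it keeps \<open>ker V 1 a\<close> among the generators.\<close>
  have ker_le_L: "ker V 1 a \<subseteq> L" if "a \<in> S" for a
  proof -
    have "ker V 1 a \<subseteq> span (\<Union>b\<in>S - {a + 1}. ker V 1 b)"
      using that by (intro subset_trans[OF _ span_superset]) auto
    then show ?thesis using L by simp
  qed
  \<comment> \<open>For generators with parameters a and b, both A + a B and A + b B vanish on the
    pair, hence so does (a - b) B. The case a = b never occurs, because \<open>y\<close> is
    expressed through generators with \<open>a\<close> omitted.\<close>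
  have isotropic_B: "B x y = 0" if x: "x \<in> L" and y: "y \<in> L" for x y
  proof (rule functional_zero_on_span[of "\<lambda>x. B x y" x "\<Union>a\<in>S - {0}. ker V 1 a"])
    show "functional (\<lambda>x. B x y)" by (rule bilinear_formD(2)[OF B])
    show "x \<in> span (\<Union>a\<in>S - {0}. ker V 1 a)" using x L by simp
    fix z assume "z \<in> (\<Union>a\<in>S - {0}. ker V 1 a)"
    then obtain a where a: "a \<in> S" "z \<in> ker V 1 a" by blast
    show "B z y = 0"
    proof (rule functional_zero_on_span[of "B z" y "\<Union>b\<in>S - {a}. ker V 1 b"])
      show "functional (B z)" by (rule bilinear_formD(1)[OF B])
      show "y \<in> span (\<Union>b\<in>S - {a}. ker V 1 b)" using y L by simp
      fix w assume "w \<in> (\<Union>b\<in>S - {a}. ker V 1 b)"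
      then obtain b where b: "b \<noteq> a" "w \<in> ker V 1 b" by blast
      have V: "z \<in> V" "w \<in> V" using a b kerV by blast+
      have "form 1 a z w = 0" using a V by (auto simp: ker_eq)
      moreover have "form 1 b z w = 0" using b V form_skew[OF V, of 1 b] by (auto simp: ker_eq)
      ultimately have "a * B z w = b * B z w" by (metis form_def add_left_cancel)
      then show "B z w = 0" using b by simp
    qed
  qed
  define M where "M = {y\<in>V. \<forall>x\<in>L. B x y = 0}"
  have M: "M = {y\<in>V. \<forall>x\<in>L. form s t x y = 0}" if st: "(s, t) \<noteq> (0, 0)" for s t
  proof (cases "s = 0")
    case True
    then show ?thesis using st by (auto simp: M_def form_def)
  next
    case False
    \<comment> \<open>The factor t - s b between \<open>form s t\<close> and \<open>B\<close> on
      \<open>ker V 1 b\<close> vanishes only at b = t / s, so exactly this value is omitted.\<close>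
    let ?G = "\<Union>b\<in>S - {t / s}. ker V 1 b"
    have gens: "(\<forall>x\<in>L. C x y = 0) \<longleftrightarrow> (\<forall>x\<in>?G. C x y = 0)" if C: "bilinear_form C" for C y
    proof (intro iffI ballI)
      fix x assume G: "\<forall>x\<in>?G. C x y = 0" and "x \<in> L"
      then have "x \<in> span ?G" using L[of "t / s"] by simp
      then show "C x y = 0"
        using functional_zero_on_span[OF bilinear_formD(2)[OF C]] G by metis
    next
      fix x assume G: "\<forall>x\<in>L. C x y = 0" and "x \<in> ?G"
      then have "x \<in> L" using span_base[of x ?G] L[of "t / s"] by simp
      then show "C x y = 0" using G by blast
    qed
    have "form s t x y = 0 \<longleftrightarrow> B x y = 0" if x: "x \<in> ?G" and y: "y \<in> V" for x y
    proof -
      obtain b where b: "b \<noteq> t / s" "x \<in> ker V 1 b" using x by blast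
      then have "A x y = - b * B x y" using y by (auto simp: ker_eq form_def add_eq_0_iff2)
      then have "form s t x y = (t - s * b) * B x y" by (simp add: form_def algebra_simps)
      moreover have "t - s * b \<noteq> 0" using b False by (auto simp: field_simps)
      ultimately show ?thesis by simp
    qed
    then have "(\<forall>x\<in>?G. form s t x y = 0) \<longleftrightarrow> (\<forall>x\<in>?G. B x y = 0)" if "y \<in> V" for y
      using that by (intro ball_cong refl) simp
    then show ?thesis unfolding M_def gens[OF B] gens[OF form[of s t]] by blast
  qed
  have subM: "subspace M"
    unfolding M_def by (rule subspace_functional_kernel[OF V bilinear_formD(1)[OF B]])
  have MV: "M \<subseteq> V" by (auto simp: M_def)
  have LM: "L \<subseteq> M" using LV isotropic_B by (auto simp: M_def)
  have dimM: "dim V + dim (L \<inter> ker V s t) = dim M + dim L" if st: "(s, t) \<noteq> (0, 0)" for s t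
  proof -
    have "{x\<in>L. \<forall>y\<in>V. form s t x y = 0} = L \<inter> ker V s t" using LV by (auto simp: ker_eq)
    then show ?thesis using dim_orthogonal[OF subL V form[of s t]] M[OF st] by simp
  qed
  obtain a0 where a0: "a0 \<in> S" using S by blast
  have "L \<inter> ker V 1 a0 = ker V 1 a0" using ker_le_L[OF a0] by blast
  then have dimM': "dim V + r = dim M + dim L" using dimM[of 1 a0] rank[of 1 a0] by simp
  have subker: "subspace (ker V s t)" for s t
    unfolding ker_eq by (rule subspace_functional_kernel[OF V bilinear_formD(2)[OF form]])
  have ker_L: "ker V s t \<subseteq> L" if st: "(s, t) \<noteq> (0, 0)" for s t
  proof -
    have "dim (L \<inter> ker V s t) = dim (ker V s t)"
      using dimM[OF st] dimM' rank[OF st] by (metis add_left_cancel)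
    then have "L \<inter> ker V s t = ker V s t"
      by (intro subspace_dim_equal subspace_inter subL subker Int_lower2) (rule eq_refl, rule sym)
    then show ?thesis by blast
  qed
  \<comment> \<open>The orthogonal space of \<open>M\<close> is compared with \<open>L\<close> by
    dimension: \<open>M\<close> contains the kernel of \<open>form s t\<close>, so the count for
    \<open>M\<close> has the same right-hand side dim V + r as the one for \<open>L\<close>.\<close>
  have M_perp: "x \<in> L" if st: "(s, t) \<noteq> (0, 0)" and x: "x \<in> M" "\<And>y. y \<in> M \<Longrightarrow> form s t x y = 0"
    for s t x
  proof -
    let ?N = "{x\<in>V. \<forall>y\<in>M. form s t x y = 0}"
    have "(\<forall>x\<in>V. form s t x y = 0) \<longleftrightarrow> (\<forall>x\<in>V. form s t y x = 0)" if "y \<in> V" for y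
      by (rule ball_cong[OF refl]) (use form_skew[OF that, of _ s t] in simp)
    then have "{y\<in>M. \<forall>x\<in>V. form s t x y = 0} = M \<inter> ker V s t"
      using MV by (auto simp: ker_eq)
    also have "\<dots> = ker V s t" using ker_L[OF st] LM by blast
    finally have "dim V + r = dim ?N + dim M"
      using dim_orthogonal[OF subM V bilinear_form_flip[OF form[of s t]]] rank[OF st] by simp
    then have N: "dim ?N = dim L" unfolding dimM' by (simp only: add.commute add_left_cancel)
    have "L \<subseteq> ?N" using LV M[OF st] by auto
    moreover have "subspace ?N" by (rule subspace_functional_kernel[OF V bilinear_formD(2)[OF form]])
    ultimately have "L = ?N" using subspace_dim_equal[OF subL, of ?N] N by (simp only: order_refl)
    then show ?thesis using x MV by blast
  qed
  have "M \<subseteq> L"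
  proof (rule ccontr)
    assume "\<not> M \<subseteq> L"
    obtain K where K: "K \<subseteq> L" "independent K" "L \<subseteq> span K"
      using maximal_independent_subset by blast
    then have "K \<subseteq> M" using LM by blast
    then obtain K' where K': "K \<subseteq> K'" "K' \<subseteq> M" "independent K'" "M \<subseteq> span K'"
      using maximal_independent_subset_extend[of K M] K(2) by blast
    have spK: "span K = L" using K span_minimal[OF K(1) subL] by blast
    have spK': "span K' = M" using K' span_minimal[OF K'(2) subM] by blast
    let ?W = "span (K' - K)"
    have decomp: "\<exists>l\<in>L. \<exists>w\<in>?W. y = l + w" if "y \<in> M" for y
    proof -
      have "y \<in> span (K \<union> (K' - K))" using that spK' K'(1) by (simp add: Un_absorb1)
      then show ?thesis unfolding span_Un spK by blast
    qed
    have W: "?W \<noteq> {0}"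
    proof
      assume "?W = {0}"
      then have "M \<subseteq> L" using decomp by fastforce
      with \<open>\<not> M \<subseteq> L\<close> show False by blast
    qed
    \<comment> \<open>A vector of \<open>?W\<close> that is singular on \<open>?W\<close> is
      orthogonal to \<open>L\<close> as well, since it lies in \<open>M\<close>; hence it is
      singular on all of \<open>M\<close>, which puts it into \<open>L\<close>.\<close>
    obtain s t w where st: "(s, t) \<noteq> (0, 0)" and w: "w \<in> ?W" "w \<noteq> 0"
        "\<And>y. y \<in> ?W \<Longrightarrow> s * A w y + t * B w y = 0"
      by (rule singular_pencil_member[OF subspace_span W A B]) (rule that)
    have wM: "w \<in> M" using w(1) spK' span_mono[of "K' - K" K'] by blast
    have "form s t w y = 0" if yM: "y \<in> M" for y
    proof -
      obtain l z where lz: "l \<in> L" "z \<in> ?W" "y = l + z" using decomp[OF yM] by blast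
      have "form s t l w = 0" using M[OF st] wM lz(1) by blast
      then have "form s t w l = 0" using form_skew[of w l s t] wM lz(1) MV LV by auto
      moreover have "form s t w z = 0" using w(3)[OF lz(2)] by (simp add: form_def)
      ultimately show ?thesis
        unfolding lz(3) by (simp add: functional_simps(1)[OF bilinear_formD(1)[OF form]])
    qed
    then have "w \<in> L" using M_perp[OF st wM] by blast
    then have "w \<in> span K \<inter> ?W" using w(1) spK by blast
    moreover have "span K \<inter> ?W = {0}"
      by (rule span_Int_span_independent) (use K'(1,3) in \<open>simp_all add: Un_absorb1\<close>)
    ultimately show False using w(2) by blast
  qed
  then show ?thesis using dimM' LM by (simp add: subset_antisym)
qed

end

section \<open>Polynomial curves in a vector space\<close>

text \<open>Polynomiality is tested weakly, one functional at a time, so neither coordinates nor a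
  bound on the degrees is fixed.\<close>

definition (in vector_space) poly_curve :: "('a \<Rightarrow> 'b) \<Rightarrow> bool"
  where "poly_curve v \<longleftrightarrow> (\<forall>\<phi>. functional \<phi> \<longrightarrow> (\<exists>p. \<forall>t. poly p t = \<phi> (v t)))"

text \<open>Indexed rather than set-based: along a curve, vectors with different indices may
  coincide at special parameters, and such a coincidence must count as dependence.\<close>

definition (in vector_space) independent_family :: "'i set \<Rightarrow> ('i \<Rightarrow> 'b) \<Rightarrow> bool"
  where "independent_family I w \<longleftrightarrow> (\<forall>c. (\<Sum>i\<in>I. scale (c i) (w i)) = 0 \<longrightarrow> (\<forall>i\<in>I. c i = 0))"

context vector_space
begin

lemma independent_familyD:
  "independent_family I w \<Longrightarrow> (\<Sum>i\<in>I. scale (c i) (w i)) = 0 \<Longrightarrow> i \<in> I \<Longrightarrow> c i = 0"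
  unfolding independent_family_def by blast

lemma independent_family_image:
  assumes "finite I" "independent_family I w"
  shows "inj_on w I" "independent (w ` I)"
proof -
  show inj: "inj_on w I"
  proof (rule inj_onI, rule ccontr)
    fix i j assume ij: "i \<in> I" "j \<in> I" "w i = w j" "i \<noteq> j"
    let ?c = "\<lambda>k. if k = i then 1 else if k = j then - 1 else 0"
    have "(\<Sum>k\<in>I. scale (?c k) (w k)) = (\<Sum>k\<in>{i, j}. scale (?c k) (w k))"
      by (rule sum.mono_neutral_right) (use assms(1) ij in auto)
    also have "\<dots> = 0" using ij by simp
    finally show False using independent_familyD[OF assms(2) _ ij(1), of ?c] by simp
  qed
  show "independent (w ` I)"
  proof (rule independent_if_scalars_zero)
    show "finite (w ` I)" using assms(1) by simp
    fix c x assume c: "(\<Sum>x\<in>w ` I. scale (c x) x) = 0" and x: "x \<in> w ` I"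
    have "(\<Sum>i\<in>I. scale (c (w i)) (w i)) = 0"
      using c unfolding sum.reindex[OF inj] by simp
    from independent_familyD[OF assms(2) this] show "c x = 0" using x by auto
  qed
qed

lemma finite_poly_zeros:
  assumes "poly_curve v" "functional \<phi>" "\<phi> (v t0) \<noteq> 0"
  shows "finite {t. \<phi> (v t) = 0}"
proof -
  obtain p where p: "\<And>t. poly p t = \<phi> (v t)"
    using assms(1,2) unfolding poly_curve_def by metis
  then have "p \<noteq> 0" using assms(3) by (metis poly_0)
  then show ?thesis using poly_roots_finite[of p] p by simp
qed

text \<open>Elimination takes the place of minors. The pivot is a polynomial in t that is non-zero
  at \<open>t0\<close>, so it has finitely many zeros, and cross-multiplication instead of division
  keeps the remaining curves polynomial.\<close>

lemma independent_family_generic: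
  assumes "finite I" "\<And>i. i \<in> I \<Longrightarrow> poly_curve (v i)" "independent_family I (\<lambda>i. v i t0)"
  shows "finite {t. \<not> independent_family I (\<lambda>i. v i t)}"
  using assms
proof (induction I arbitrary: v)
  case empty
  then show ?case by (simp add: independent_family_def)
next
  case (insert j I v)
  have "v j t0 \<noteq> 0"
  proof
    let ?c = "\<lambda>k. if k = j then 1 else 0"
    assume "v j t0 = 0"
    then have "(\<Sum>i\<in>insert j I. scale (?c i) (v i t0)) = 0"
      by (intro sum.neutral) auto
    from independent_familyD[OF insert.prems(2) this, of j] show False by simp
  qed
  then have "v j t0 \<notin> span {}" by simp
  then obtain \<phi> where \<phi>: "functional \<phi>" "\<phi> (v j t0) = 1"
    using separating_functional by metis
  \<comment> \<open>Elimination: subtracting multiples of \<open>v j\<close> moves the other curves into the kernel of \<open>\<phi>\<close>.\<close>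
  define v' where "v' i t = scale (\<phi> (v j t)) (v i t) - scale (\<phi> (v i t)) (v j t)" for i t
  have split: "(\<Sum>i\<in>insert j I. scale (d i) (v i t)) = scale (d j) (v j t) + (\<Sum>i\<in>I. scale (d i) (v i t))" for d t
    using insert.hyps by simp
  have v'_sum: "(\<Sum>i\<in>I. scale (c i) (v' i t)) = scale (\<phi> (v j t)) (\<Sum>i\<in>I. scale (c i) (v i t))
      - scale (\<phi> (\<Sum>i\<in>I. scale (c i) (v i t))) (v j t)" for c t
    unfolding v'_def by (simp add: functional_simps[OF \<phi>(1)] scale_right_diff_distrib sum_subtractf
      scale_sum_right scale_sum_left mult.commute)
  have "poly_curve (v' i)" if i: "i \<in> I" for i
    unfolding poly_curve_def
  proof (intro allI impI)
    fix \<psi> assume \<psi>: "functional \<psi>"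
    have ex: "\<exists>p. \<forall>t. poly p t = \<psi> (v k t)" if "functional \<psi>" "k \<in> insert j I" for \<psi> k
      using insert.prems(1)[OF that(2)] that(1) unfolding poly_curve_def by blast
    obtain p1 p2 p3 p4 where "\<forall>t. poly p1 t = \<phi> (v j t)" "\<forall>t. poly p2 t = \<psi> (v i t)"
        "\<forall>t. poly p3 t = \<phi> (v i t)" "\<forall>t. poly p4 t = \<psi> (v j t)"
      using ex[OF \<phi>(1)] ex[OF \<psi>] i by (meson insertI1 insertI2)
    then have "\<forall>t. poly (p1 * p2 - p3 * p4) t = \<psi> (v' i t)"
      by (simp add: v'_def functional_simps[OF \<psi>])
    then show "\<exists>p. \<forall>t. poly p t = \<psi> (v' i t)" by blast
  qed
  moreover have "independent_family I (\<lambda>i. v' i t0)"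
    unfolding independent_family_def
  proof (intro allI impI ballI)
    fix c i assume c: "(\<Sum>i\<in>I. scale (c i) (v' i t0)) = 0" and i: "i \<in> I"
    \<comment> \<open>Because \<phi> is 1 on \<open>v j t0\<close>, a relation between the
      eliminated vectors at \<open>t0\<close> is a relation between the original ones with this
      coefficient at \<open>j\<close>.\<close>
    let ?d = "\<lambda>i. if i = j then - \<phi> (\<Sum>i\<in>I. scale (c i) (v i t0)) else c i"
    have "(\<Sum>i\<in>I. scale (?d i) (v i t0)) = (\<Sum>i\<in>I. scale (c i) (v i t0))"
      by (rule sum.cong) (use insert.hyps in auto)
    then have "(\<Sum>i\<in>insert j I. scale (?d i) (v i t0)) = 0"
      unfolding split using c unfolding v'_sum by (simp add: \<phi>)
    from independent_familyD[OF insert.prems(2) this, of i] show "c i = 0"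
      using i insert.hyps by (auto split: if_splits)
  qed
  ultimately have "finite {t. \<not> independent_family I (\<lambda>i. v' i t)}"
    using insert.IH by blast
  moreover have "finite {t. \<phi> (v j t) = 0}"
    using finite_poly_zeros[of "v j" \<phi> t0] insert.prems(1) \<phi> by simp
  moreover have "independent_family (insert j I) (\<lambda>i. v i t)"
    if ind: "independent_family I (\<lambda>i. v' i t)" and nz: "\<phi> (v j t) \<noteq> 0" for t
    unfolding independent_family_def
  proof (intro allI impI)
    fix c assume "(\<Sum>i\<in>insert j I. scale (c i) (v i t)) = 0"
    then have c: "(\<Sum>i\<in>I. scale (c i) (v i t)) = - scale (c j) (v j t)"
      unfolding split by (simp add: add_eq_0_iff)
    then have "(\<Sum>i\<in>I. scale (c i) (v' i t)) = 0"
      unfolding v'_sum by (simp add: functional_simps[OF \<phi>(1)] mult.commute)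
    then have cI: "c i = 0" if "i \<in> I" for i using independent_familyD[OF ind] that by blast
    then have "scale (c j) (v j t) = 0" using c by simp
    then have "c j = 0" using nz functional_simps(3)[OF \<phi>(1)] by auto
    then show "\<forall>i\<in>insert j I. c i = 0" using cI by blast
  qed
  ultimately show ?case
    by (rule_tac finite_subset[of _ "{t. \<not> independent_family I (\<lambda>i. v' i t)} \<union> {t. \<phi> (v j t) = 0}"]) auto
qed

text \<open>Interpolation without Vandermonde matrices: a functional that kills \<open>U\<close> but
  not \<open>w j\<close> would give a non-zero polynomial vanishing on the infinite set
  \<open>T\<close>.\<close>

lemma poly_curve_coefficients:
  assumes "infinite T" "subspace U" "\<And>t. t \<in> T \<Longrightarrow> (\<Sum>i<n. scale (t ^ i) (w i)) \<in> U" "j < n"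
  shows "w j \<in> U"
proof (rule ccontr)
  assume "w j \<notin> U"
  then have "w j \<notin> span U" using assms(2) by (metis span_eq_iff)
  then obtain \<phi> where \<phi>: "functional \<phi>" "\<And>y. y \<in> span U \<Longrightarrow> \<phi> y = 0" "\<phi> (w j) = 1"
    using separating_functional by metis
  let ?p = "\<Sum>i<n. Polynomial.monom (\<phi> (w i)) i"
  have "poly ?p t = 0" if "t \<in> T" for t
    using \<phi>(2)[OF span_base[OF assms(3)[OF that]]]
    by (simp add: functional_simps[OF \<phi>(1)] poly_sum poly_monom mult.commute)
  then have "T \<subseteq> {t. poly ?p t = 0}" by blast
  then have "infinite {t. poly ?p t = 0}" using assms(1) finite_subset by blast
  then have "?p = 0" using poly_roots_finite by blast
  moreover have "Polynomial.coeff ?p j = \<phi> (w j)" using assms(4) by (simp add: Polynomial.coeff_sum)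
  ultimately show False using \<phi>(3) by simp
qed

end

text \<open>Semicontinuity of the rank, for a possibly infinite family: a basis at \<open>t0\<close>
  involves only finitely many members \<open>h b\<close>, and these stay independent for almost all
  t.\<close>

lemma (in finite_dimensional_vector_space) generic_dim:
  assumes "\<And>f. f \<in> F \<Longrightarrow> poly_curve (v f)"
  shows "finite {t. dim {v f t | f. f \<in> F} < dim {v f t0 | f. f \<in> F}}"
proof -
  obtain B where B: "B \<subseteq> {v f t0 | f. f \<in> F}" "independent B" "card B = dim {v f t0 | f. f \<in> F}"
    by (rule basis_exists[of "{v f t0 | f. f \<in> F}"]) (rule that)
  have "\<forall>b\<in>B. \<exists>f\<in>F. b = v f t0" using B(1) by auto
  then obtain h where h: "\<And>b. b \<in> B \<Longrightarrow> h b \<in> F" "\<And>b. b \<in> B \<Longrightarrow> v (h b) t0 = b" by metis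
  have fin: "finite B" using finiteI_independent[OF B(2)] .
  have "independent_family B (\<lambda>b. v (h b) t0)"
    unfolding independent_family_def
  proof (intro allI impI)
    fix c assume "(\<Sum>b\<in>B. scale (c b) (v (h b) t0)) = 0"
    then have "(\<Sum>b\<in>B. scale (c b) b) = 0" using h(2) by simp
    then show "\<forall>b\<in>B. c b = 0" using B(2) independent_explicit by blast
  qed
  then have "finite {t. \<not> independent_family B (\<lambda>b. v (h b) t)}"
    by (intro independent_family_generic[OF fin] assms h(1))
  moreover have "dim {v f t | f. f \<in> F} \<ge> dim {v f t0 | f. f \<in> F}"
    if "independent_family B (\<lambda>b. v (h b) t)" for t
  proof -
    note I = independent_family_image[OF fin that]
    have "card ((\<lambda>b. v (h b) t) ` B) \<le> dim {v f t | f. f \<in> F}"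
      by (rule independent_card_le_dim[OF _ I(2)]) (use h(1) in blast)
    then show ?thesis using card_image[OF I(1)] B(3) by simp
  qed
  ultimately show ?thesis
    by (elim finite_subset[rotated]) (auto simp: not_le[symmetric])
qed

section \<open>Polynomial functions along lines\<close>

text \<open>The description in \<open>as_poly\<close> denotes only if the polynomial is unique;
  characteristic zero provides this, as the field is then infinite.\<close>

lemma as_poly_eqI:
  fixes p :: "'k::field_char_0 poly"
  assumes "\<And>t. poly p t = h t"
  shows "as_poly h = p"
  unfolding as_poly_def
proof (rule the_equality)
  show "\<forall>t. poly p t = h t" using assms by simp
  fix p' assume "\<forall>t. poly p' t = h t"
  then have "poly p' = poly p" using assms by auto
  then show "p' = p" by (simp add: poly_eq_poly_eq_iff)
qed

text \<open>Instantiated twice: for matrices with their entries, which gives the tangent space of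
  the group, and for the dual space of \<open>q\<close> with the evaluations, which gives the
  symmetric algebra.\<close>

locale line_polynomials = vector_space scale
  for scale :: "'k::field_char_0 \<Rightarrow> 'v::ab_group_add \<Rightarrow> 'v" +
  fixes D :: "'v set" and G :: "('v \<Rightarrow> 'k) set"
  assumes subspace_D: "subspace D"
    and generator_line: "g \<in> G \<Longrightarrow> x \<in> D \<Longrightarrow> y \<in> D \<Longrightarrow> g (x + scale t y) = g x + t * g y"
begin

abbreviation "polys \<equiv> generated_algebra D G"

definition line :: "('v \<Rightarrow> 'k) \<Rightarrow> 'v \<Rightarrow> 'v \<Rightarrow> 'k poly"
  where "line f x y = as_poly (\<lambda>t. f (x + scale t y))"

definition der :: "('v \<Rightarrow> 'k) \<Rightarrow> 'v \<Rightarrow> 'v \<Rightarrow> 'k"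
  where "der f x y = Polynomial.coeff (line f x y) 1"

lemma line_in_D: "x \<in> D \<Longrightarrow> y \<in> D \<Longrightarrow> x + scale t y \<in> D"
  using subspace_D by (simp add: subspace_add subspace_scale)

lemma line_const: "x \<in> D \<Longrightarrow> y \<in> D \<Longrightarrow> line (const_on D c) x y = [:c:]"
  unfolding line_def by (rule as_poly_eqI) (simp add: const_on_def line_in_D)

lemma line_gen: "g \<in> G \<Longrightarrow> x \<in> D \<Longrightarrow> y \<in> D \<Longrightarrow> line g x y = [:g x, g y:]"
  unfolding line_def by (rule as_poly_eqI) (simp add: generator_line)

lemma poly_line:
  assumes "f \<in> polys" "x \<in> D" "y \<in> D"
  shows "poly (line f x y) t = f (x + scale t y)"
proof -
  have "\<exists>p. \<forall>t. poly p t = f (x + scale t y)"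
    using assms(1)
  proof induction
    case (const c)
    then show ?case using assms(2,3)
      by (intro exI[of _ "[:c:]"]) (simp add: const_on_def line_in_D)
  next
    case (gen g)
    then show ?case using assms(2,3)
      by (intro exI[of _ "[:g x, g y:]"]) (simp add: generator_line)
  next
    case (add f g)
    then obtain p q where "\<forall>t. poly p t = f (x + scale t y)" "\<forall>t. poly q t = g (x + scale t y)" by blast
    then show ?case by (intro exI[of _ "p + q"]) simp
  next
    case (mult f g)
    then obtain p q where "\<forall>t. poly p t = f (x + scale t y)" "\<forall>t. poly q t = g (x + scale t y)" by blast
    then show ?case by (intro exI[of _ "p * q"]) simp
  qed
  then obtain p where p: "\<And>t. poly p t = f (x + scale t y)" by blast
  then have "line f x y = p" unfolding line_def by (rule as_poly_eqI)
  then show ?thesis using p by simp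
qed

lemma line_eqI:
  assumes "\<And>t. poly p t = f (x + scale t y)"
  shows "line f x y = p"
  unfolding line_def using assms by (rule as_poly_eqI)

lemma line_add:
  "f \<in> polys \<Longrightarrow> g \<in> polys \<Longrightarrow> x \<in> D \<Longrightarrow> y \<in> D \<Longrightarrow> line (f + g) x y = line f x y + line g x y"
  by (rule line_eqI) (simp add: poly_line)

lemma line_mult:
  "f \<in> polys \<Longrightarrow> g \<in> polys \<Longrightarrow> x \<in> D \<Longrightarrow> y \<in> D \<Longrightarrow> line (f * g) x y = line f x y * line g x y"
  by (rule line_eqI) (simp add: poly_line)

lemma coeff_line_0: "f \<in> polys \<Longrightarrow> x \<in> D \<Longrightarrow> y \<in> D \<Longrightarrow> Polynomial.coeff (line f x y) 0 = f x"
  using poly_line[of f x y 0] by (simp add: poly_0_coeff_0)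

lemma der_const: "x \<in> D \<Longrightarrow> y \<in> D \<Longrightarrow> der (const_on D c) x y = 0"
  by (simp add: der_def line_const)

lemma der_gen: "g \<in> G \<Longrightarrow> x \<in> D \<Longrightarrow> y \<in> D \<Longrightarrow> der g x y = g y"
  by (simp add: der_def line_gen)

lemma der_add:
  "f \<in> polys \<Longrightarrow> g \<in> polys \<Longrightarrow> x \<in> D \<Longrightarrow> y \<in> D \<Longrightarrow> der (f + g) x y = der f x y + der g x y"
  by (simp add: der_def line_add)

lemma der_mult:
  "f \<in> polys \<Longrightarrow> g \<in> polys \<Longrightarrow> x \<in> D \<Longrightarrow> y \<in> D \<Longrightarrow>
    der (f * g) x y = f x * der g x y + der f x y * g x"
  by (simp add: der_def line_mult Polynomial.coeff_mult coeff_line_0 atMost_Suc)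

lemma der_scale_direction:
  assumes "f \<in> polys" "x \<in> D" "y \<in> D"
  shows "der f x (scale c y) = c * der f x y"
proof -
  have "line f x (scale c y) = pcompose (line f x y) [:0, c:]"
    by (rule line_eqI) (use assms in \<open>simp add: poly_line poly_pcompose mult.commute\<close>)
  then show ?thesis by (simp add: der_def coeff_pcompose_linear)
qed

text \<open>Unlike rescaling, adding directions is no reparametrisation of a line, so the proof
  follows the generation of \<open>f\<close> by the Leibniz rule.\<close>

lemma der_add_direction:
  assumes "f \<in> polys" "x \<in> D" "y \<in> D" "z \<in> D"
  shows "der f x (y + z) = der f x y + der f x z"
  using assms(1)
proof induction
  case (gen g)
  have "g (y + z) = g y + g z" using generator_line[OF gen assms(3,4), of 1] by simp
  then show ?case using gen assms by (simp add: der_gen subspace_add[OF subspace_D])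
next
  case (const c)
  then show ?case using assms by (simp add: der_const subspace_add[OF subspace_D])
next
  case (add f g)
  have eq: "der (f + g) x w = der f x w + der g x w" if "w \<in> D" for w
    using add.hyps assms(2) that by (rule der_add)
  show ?case
    unfolding eq[OF assms(3)] eq[OF assms(4)] eq[OF subspace_add[OF subspace_D assms(3,4)]] add.IH
    by (simp add: algebra_simps)
next
  case (mult f g)
  have eq: "der (f * g) x w = f x * der g x w + der f x w * g x" if "w \<in> D" for w
    using mult.hyps assms(2) that by (rule der_mult)
  show ?case
    unfolding eq[OF assms(3)] eq[OF assms(4)] eq[OF subspace_add[OF subspace_D assms(3,4)]] mult.IH
    by (simp add: algebra_simps)
qed

lemma polys_sum:
  "(\<And>i. i \<in> I \<Longrightarrow> f i \<in> polys) \<Longrightarrow> (\<Sum>i\<in>I. f i) \<in> polys"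
proof (induction I rule: infinite_finite_induct)
  case (insert i I)
  then show ?case
    unfolding sum.insert[OF insert.hyps] by (intro generated_algebra.add) auto
qed (use generated_algebra.const[of D 0 G] in \<open>simp_all add: const_on_def zero_fun_def\<close>)

end

section \<open>The tangent space of a matrix group\<close>

text \<open>The basis is an abstract one; the matrix units \<open>?E\<close> serve only to bound its
  size.\<close>

lemma finite_dimensional_mscale:
  "finite_dimensional_vector_space (mscale :: 'k::field \<Rightarrow> 'k^'n^'m \<Rightarrow> 'k^'n^'m) (matsp.extend_basis {})"
proof
  let ?E = "range (\<lambda>(i, j). (\<chi> a b. if b = j then if a = i then 1 else 0 else 0) :: 'k^'n^'m)"
  let ?B = "matsp.extend_basis {} :: ('k^'n^'m) set"
  have ind: "\<not> matsp.dependent ({} :: ('k^'n^'m) set)" by (simp add: matsp.dependent_def)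
  show B: "\<not> matsp.dependent ?B" using matsp.independent_extend_basis[OF ind] .
  show "matsp.span ?B = UNIV" using matsp.span_extend_basis[OF ind] .
  have "x \<in> matsp.span ?E" for x :: "'k^'n^'m"
  proof -
    have "x = (\<Sum>i\<in>UNIV. \<Sum>j\<in>UNIV. mscale (x $ i $ j) (\<chi> a b. if b = j then if a = i then 1 else 0 else 0))"
    proof (simp only: vec_eq_iff, intro allI)
      fix a b
      have "(\<Sum>j\<in>UNIV. x $ i $ j * (if b = j then if a = i then 1 else 0 else 0))
          = (if a = i then x $ i $ b else 0)" for i
        by (simp add: if_distrib[of "(*) _"] cong: if_cong)
      then show "x $ a $ b = (\<Sum>i\<in>UNIV. \<Sum>j\<in>UNIV.
          mscale (x $ i $ j) (\<chi> a b. if b = j then if a = i then 1 else 0 else 0)) $ a $ b"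
        by (simp add: mscale_def)
    qed
    also have "\<dots> \<in> matsp.span ?E"
      by (intro matsp.span_sum matsp.span_scale matsp.span_base) force
    finally show ?thesis .
  qed
  then have "matsp.span ?E = UNIV" by blast
  then show "finite ?B"
    using matsp.independent_span_bound[OF _ B, of ?E] by simp
qed

interpretation matpoly: line_polynomials "mscale :: 'k::field_char_0 \<Rightarrow> 'k^'n^'n \<Rightarrow> 'k^'n^'n" UNIV
  "{\<lambda>A. A $ i $ j | i j. True}"
  by unfold_locales (auto simp: mscale_def)

lemma matrix_polys_coordinate: "(\<lambda>A. A $ i $ j) \<in> matrix_polys"
  unfolding matrix_polys_def by (rule generated_algebra.gen) blast

lemma matrix_polys_const: "(\<lambda>A. c) \<in> matrix_polys"
  using generated_algebra.const[of UNIV c] unfolding matrix_polys_def const_on_def by simp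

lemma matrix_polys_sum:
  fixes f :: "'i \<Rightarrow> 'k::field_char_0^'n^'n \<Rightarrow> 'k"
  assumes "\<And>i. i \<in> I \<Longrightarrow> f i \<in> matrix_polys"
  shows "(\<lambda>A. \<Sum>i\<in>I. f i A) \<in> matrix_polys"
proof -
  have "(\<Sum>i\<in>I. f i) = (\<lambda>A. \<Sum>i\<in>I. f i A)"
    by (induction I rule: infinite_finite_induct) auto
  then show ?thesis using matpoly.polys_sum[of I f] assms unfolding matrix_polys_def by simp
qed

lemma matrix_polys_mult:
  assumes "f \<in> matrix_polys" "g \<in> matrix_polys"
  shows "(\<lambda>A. f A * g A) \<in> matrix_polys"
  using generated_algebra.mult[OF assms[unfolded matrix_polys_def]]
  unfolding matrix_polys_def by (simp add: times_fun_def)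

lemma matrix_polys_add:
  assumes "f \<in> matrix_polys" "g \<in> matrix_polys"
  shows "(\<lambda>A. f A + g A) \<in> matrix_polys"
  using generated_algebra.add[OF assms[unfolded matrix_polys_def]]
  unfolding matrix_polys_def by (simp add: plus_fun_def)

lemma matrix_polys_induct [consumes 1, case_names const coordinate add mult]:
  assumes "f \<in> matrix_polys"
    and "\<And>c. P (\<lambda>A. c)"
    and "\<And>i j. P (\<lambda>A. A $ i $ j)"
    and "\<And>f g. f \<in> matrix_polys \<Longrightarrow> P f \<Longrightarrow> g \<in> matrix_polys \<Longrightarrow> P g \<Longrightarrow> P (\<lambda>A. f A + g A)"
    and "\<And>f g. f \<in> matrix_polys \<Longrightarrow> P f \<Longrightarrow> g \<in> matrix_polys \<Longrightarrow> P g \<Longrightarrow> P (\<lambda>A. f A * g A)"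
  shows "P f"
  using assms(1) unfolding matrix_polys_def
proof induction
  case (const c)
  then show ?case using assms(2)[of c] by (simp add: const_on_def)
next
  case (gen f)
  then show ?case using assms(3) by auto
next
  case (add f g)
  then show ?case using assms(4)[of f g] unfolding matrix_polys_def plus_fun_def by simp
next
  case (mult f g)
  then show ?case using assms(5)[of f g] unfolding matrix_polys_def times_fun_def by simp
qed

lemma matder_simps:
  fixes f g :: "'k::field_char_0^'n^'n \<Rightarrow> 'k"
  shows "matpoly.der (\<lambda>A. c) A Y = 0"
    "matpoly.der (\<lambda>A. A $ i $ j) A Y = Y $ i $ j"
    "f \<in> matrix_polys \<Longrightarrow> g \<in> matrix_polys \<Longrightarrow>
      matpoly.der (\<lambda>A. f A + g A) A Y = matpoly.der f A Y + matpoly.der g A Y"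
    "f \<in> matrix_polys \<Longrightarrow> g \<in> matrix_polys \<Longrightarrow>
      matpoly.der (\<lambda>A. f A * g A) A Y = f A * matpoly.der g A Y + matpoly.der f A Y * g A"
  using matpoly.der_const[of A Y c] matpoly.der_gen[of "\<lambda>A. A $ i $ j" A Y]
    matpoly.der_add[of f g A Y] matpoly.der_mult[of f g A Y]
  by (auto simp: matrix_polys_def const_on_def plus_fun_def times_fun_def)

lemma matder_linear_coordinate:
  fixes Y :: "'k::field_char_0^'n^'n"
  shows "matpoly.der (\<lambda>A. (A ** x) $ i $ j) A Y = (Y ** x) $ i $ j"
proof -
  have "matpoly.line (\<lambda>A. (A ** x) $ i $ j) A Y = [:(A ** x) $ i $ j, (Y ** x) $ i $ j:]"
    by (rule matpoly.line_eqI)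
      (simp add: matrix_matrix_mult_def mscale_def algebra_simps sum.distrib sum_distrib_left)
  then show ?thesis by (simp add: matpoly.der_def)
qed

lemma matrix_polys_translate:
  fixes f :: "'k::field_char_0^'n^'n \<Rightarrow> 'k"
  assumes "f \<in> matrix_polys"
  shows "(\<lambda>A. f (g ** A)) \<in> matrix_polys"
  using assms
proof (induction rule: matrix_polys_induct)
  case (coordinate i j)
  then show ?case
    by (simp add: matrix_matrix_mult_def)
      (intro matrix_polys_sum matrix_polys_mult matrix_polys_const matrix_polys_coordinate)
qed (simp_all add: matrix_polys_const matrix_polys_add matrix_polys_mult)

text \<open>
  The left invariant vector fields of elements of the tangent space preserve the ideal of a group,
  hence so do their commutators.
\<close>

definition left_invariant_field :: "'k::field_char_0^'n^'n \<Rightarrow> ('k^'n^'n \<Rightarrow> 'k) \<Rightarrow> 'k^'n^'n \<Rightarrow> 'k"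
  where "left_invariant_field x f = (\<lambda>A. matpoly.der f A (A ** x))"

lemma left_invariant_field_simps:
  "left_invariant_field x (\<lambda>A. c) = (\<lambda>A. 0)"
  "left_invariant_field x (\<lambda>A. A $ i $ j) = (\<lambda>A. (A ** x) $ i $ j)"
  "f \<in> matrix_polys \<Longrightarrow> g \<in> matrix_polys \<Longrightarrow> left_invariant_field x (\<lambda>A. f A + g A)
    = (\<lambda>A. left_invariant_field x f A + left_invariant_field x g A)"
  "f \<in> matrix_polys \<Longrightarrow> g \<in> matrix_polys \<Longrightarrow> left_invariant_field x (\<lambda>A. f A * g A)
    = (\<lambda>A. f A * left_invariant_field x g A + left_invariant_field x f A * g A)"
  by (simp_all add: left_invariant_field_def matder_simps)

lemma left_invariant_field_linear_coordinate:
  "left_invariant_field y (\<lambda>A. (A ** x) $ i $ j) = (\<lambda>A. (A ** y ** x) $ i $ j)"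
  by (simp add: left_invariant_field_def matder_linear_coordinate)

lemma left_invariant_field_polys:
  assumes "f \<in> matrix_polys"
  shows "left_invariant_field x f \<in> matrix_polys"
  using assms
proof (induction rule: matrix_polys_induct)
  case (coordinate i j)
  then show ?case
    by (simp add: left_invariant_field_simps matrix_matrix_mult_def matrix_polys_sum
        matrix_polys_mult matrix_polys_const matrix_polys_coordinate)
qed (simp_all add: left_invariant_field_simps matrix_polys_const matrix_polys_add matrix_polys_mult)

text \<open>The second-order cross terms cancel, so both sides are derivations in \<open>f\<close>;
  it then suffices to compare them on matrix entries.\<close>

lemma left_invariant_field_commutator:
  fixes f :: "'k::field_char_0^'n^'n \<Rightarrow> 'k"
  assumes "f \<in> matrix_polys"
  shows "left_invariant_field y (left_invariant_field x f) A
      - left_invariant_field x (left_invariant_field y f) A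
    = left_invariant_field (lie_bracket y x) f A"
  using assms
proof (induction rule: matrix_polys_induct)
  case (coordinate i j)
  have "A ** lie_bracket y x = A ** y ** x - A ** x ** y"
  proof -
    have "A ** (U - V) = A ** U - A ** V" for U V :: "'k^'n^'n"
      by (simp add: vec_eq_iff matrix_matrix_mult_def right_diff_distrib sum_subtractf)
    then show ?thesis by (simp add: lie_bracket_def matrix_mul_assoc)
  qed
  then show ?case
    by (simp add: left_invariant_field_simps left_invariant_field_linear_coordinate)
next
  case (mult f g)
  then show ?case
    by (simp add: left_invariant_field_simps left_invariant_field_polys matrix_polys_mult algebra_simps)
next
  case (add f g)
  then show ?case
    by (simp add: left_invariant_field_simps left_invariant_field_polys algebra_simps)
qed (simp add: left_invariant_field_simps)

lemma lie_algebra_alt: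
  "lie_algebra Q = {x. \<forall>f\<in>matrix_polys. (\<forall>A\<in>Q. f A = 0) \<longrightarrow> matpoly.der f (mat 1) x = 0}"
  by (simp add: lie_algebra_def matpoly.der_def matpoly.line_def)

lemma matder_direction:
  assumes "f \<in> matrix_polys"
  shows "matpoly.der f A (x + y) = matpoly.der f A x + matpoly.der f A y"
    "matpoly.der f A (mscale c x) = c * matpoly.der f A x"
  using matpoly.der_add_direction matpoly.der_scale_direction assms
  unfolding matrix_polys_def by blast+

lemma subspace_lie_algebra: "matsp.subspace (lie_algebra (Q :: ('k::field_char_0^'n^'n) set))"
proof (rule matsp.subspaceI)
  have "matpoly.der f (mat 1) 0 = 0" if "f \<in> matrix_polys" for f :: "'k^'n^'n \<Rightarrow> 'k"
    using matpoly.der_scale_direction[of f "mat 1" 0 0] that by (simp add: matrix_polys_def)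
  then show "0 \<in> lie_algebra Q" by (simp add: lie_algebra_alt)
qed (simp_all add: lie_algebra_alt matder_direction)

text \<open>The commutator of the fields is evaluated at the identity. The result matters because
  elements of \<open>dual_space q\<close> are linear on \<open>q\<close> only and vanish outside
  it.\<close>

lemma lie_bracket_in_lie_algebra:
  fixes Q :: "('k::field_char_0^'n^'n) set"
  assumes one: "mat 1 \<in> Q" and mult: "\<And>A B. A \<in> Q \<Longrightarrow> B \<in> Q \<Longrightarrow> A ** B \<in> Q"
    and x: "x \<in> lie_algebra Q" and y: "y \<in> lie_algebra Q"
  shows "lie_bracket x y \<in> lie_algebra Q"
proof -
  have vanish: "left_invariant_field z f g = 0"
    if z: "z \<in> lie_algebra Q" and f: "f \<in> matrix_polys" "\<forall>A\<in>Q. f A = 0" and g: "g \<in> Q" for z f g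
  proof -
    \<comment> \<open>Left translation by \<open>g\<close> preserves the ideal of \<open>Q\<close>,
      and turns the derivative at the identity along \<open>z\<close> into the one at
      \<open>g\<close> along \<open>g ** z\<close>.\<close>
    have "matpoly.der (\<lambda>A. f (g ** A)) (mat 1) z = 0"
      using z f g mult matrix_polys_translate[OF f(1)] by (simp add: lie_algebra_alt)
    moreover have "g ** (mat 1 + mscale t z) = g + mscale t (g ** z)" for t
      by (simp add: matrix_add_ldistrib) (simp add: vec_eq_iff matrix_matrix_mult_def mscale_def
          sum_distrib_left mult.left_commute)
    ultimately show ?thesis
      by (simp add: left_invariant_field_def matpoly.der_def matpoly.line_def)
  qed
  have "matpoly.der f (mat 1) (lie_bracket x y) = 0"
    if f: "f \<in> matrix_polys" "\<forall>A\<in>Q. f A = 0" for f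
  proof -
    have "left_invariant_field x (left_invariant_field y f) (mat 1) = 0"
      "left_invariant_field y (left_invariant_field x f) (mat 1) = 0"
      using vanish x y f one left_invariant_field_polys[OF f(1)] by blast+
    then have "left_invariant_field (lie_bracket x y) f (mat 1) = 0"
      using left_invariant_field_commutator[OF f(1), of x y "mat 1"] by simp
    then show ?thesis by (simp add: left_invariant_field_def)
  qed
  then show ?thesis by (simp add: lie_algebra_alt)
qed

section \<open>Differentials and shifts\<close>

lemma coeff_mult_degree_le:
  assumes "Polynomial.degree p \<le> d" "Polynomial.degree q \<le> e"
  shows "Polynomial.coeff (p * q) (d + e) = Polynomial.coeff p d * Polynomial.coeff q e"
proof -
  have "Polynomial.coeff (p * q) (d + e)
      = (\<Sum>i\<le>d + e. Polynomial.coeff p i * Polynomial.coeff q (d + e - i))"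
    by (rule Polynomial.coeff_mult)
  also have "\<dots> = (\<Sum>i\<in>{d}. Polynomial.coeff p i * Polynomial.coeff q (d + e - i))"
  proof (rule sum.mono_neutral_right)
    show "\<forall>i\<in>{..d + e} - {d}. Polynomial.coeff p i * Polynomial.coeff q (d + e - i) = 0"
    proof
      fix i assume "i \<in> {..d + e} - {d}"
      then have "i > d \<or> d + e - i > e" by auto
      then show "Polynomial.coeff p i * Polynomial.coeff q (d + e - i) = 0"
        using assms by (auto simp: Polynomial.coeff_eq_0)
    qed
  qed auto
  finally show ?thesis by simp
qed

lemma poly_sum_le:
  fixes p :: "'a::comm_semiring_1 poly"
  assumes "Polynomial.degree p \<le> d"
  shows "poly p a = (\<Sum>j\<le>d. Polynomial.coeff p j * a ^ j)"
  unfolding poly_altdef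
  by (rule sum.mono_neutral_left) (use assms in \<open>auto simp: Polynomial.coeff_eq_0\<close>)

locale matrix_subspace =
  fixes q :: "('k::field_char_0^'n^'n) set"
  assumes subspace_q: "matsp.subspace q"
begin

lemma dualD:
  assumes "\<nu> \<in> dual_space q"
  shows "x \<in> q \<Longrightarrow> y \<in> q \<Longrightarrow> \<nu> (x + y) = \<nu> x + \<nu> y" "x \<in> q \<Longrightarrow> \<nu> (mscale c x) = c * \<nu> x"
    "x \<notin> q \<Longrightarrow> \<nu> x = 0" "\<nu> 0 = 0"
proof -
  show "x \<in> q \<Longrightarrow> y \<in> q \<Longrightarrow> \<nu> (x + y) = \<nu> x + \<nu> y"
    and sc: "\<And>x c. x \<in> q \<Longrightarrow> \<nu> (mscale c x) = c * \<nu> x" and "x \<notin> q \<Longrightarrow> \<nu> x = 0"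
    using assms unfolding dual_space_def by blast+
  show "\<nu> 0 = 0" using sc[of 0 0] matsp.subspace_0[OF subspace_q] by simp
qed

lemma dual_sum:
  assumes "\<nu> \<in> dual_space q" "\<And>i. i \<in> I \<Longrightarrow> w i \<in> q"
  shows "\<nu> (\<Sum>i\<in>I. mscale (c i) (w i)) = (\<Sum>i\<in>I. c i * \<nu> (w i))"
  using assms(2)
proof (induction I rule: infinite_finite_induct)
  case (insert i I)
  have "(\<Sum>i\<in>I. mscale (c i) (w i)) \<in> q"
    using insert by (intro matsp.subspace_sum matsp.subspace_scale subspace_q) auto
  then show ?case
    using insert dualD[OF assms(1)] matsp.subspace_scale[OF subspace_q] by simp
qed (simp_all add: dualD[OF assms(1)])

lemma subspace_dual_space: "funsp.subspace (dual_space q)"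
  by (rule funsp.subspaceI) (auto simp: dual_space_def fscale_def algebra_simps)

lemma dual_add_scale:
  "\<mu> \<in> dual_space q \<Longrightarrow> \<nu> \<in> dual_space q \<Longrightarrow> \<mu> + fscale t \<nu> \<in> dual_space q"
  using subspace_dual_space by (intro funsp.subspace_add funsp.subspace_scale)

sublocale sym: line_polynomials "fscale :: 'k \<Rightarrow> ('k^'n^'n \<Rightarrow> 'k) \<Rightarrow> _" "dual_space q" "evaluation q ` q"
proof
  show "funsp.subspace (dual_space q)" by (rule subspace_dual_space)
  fix g \<mu> \<nu> t assume "g \<in> evaluation q ` q" and \<mu>: "\<mu> \<in> dual_space q" and \<nu>: "\<nu> \<in> dual_space q"
  then obtain x where "g = evaluation q x" by blast
  then show "g (\<mu> + fscale t \<nu>) = g \<mu> + t * g \<nu>"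
    unfolding evaluation_def using \<mu> \<nu> dual_add_scale[OF \<mu> \<nu>] by (simp only: if_True) (simp add: fscale_def)
qed

lemma separating_dual:
  assumes "x \<in> q" "x \<noteq> 0"
  obtains \<nu> where "\<nu> \<in> dual_space q" "\<nu> x \<noteq> 0"
proof -
  have "x \<notin> matsp.span {}" using assms(2) by simp
  then obtain \<phi> where \<phi>: "matsp.functional \<phi>" "\<phi> x = 1"
    using matsp.separating_functional by metis
  show thesis
    by (rule that[of "\<lambda>y. if y \<in> q then \<phi> y else 0"])
      (use \<phi> assms(1) subspace_q in \<open>auto simp: dual_space_def matsp.functional_simps
        matsp.subspace_add matsp.subspace_scale\<close>)
qed

lemma dual_eqI:
  assumes "x \<in> q" "y \<in> q" "\<And>\<nu>. \<nu> \<in> dual_space q \<Longrightarrow> \<nu> x = \<nu> y"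
  shows "x = y"
proof (rule ccontr)
  assume "x \<noteq> y"
  then obtain \<nu> where \<nu>: "\<nu> \<in> dual_space q" "\<nu> (x - y) \<noteq> 0"
    using separating_dual[of "x - y"] matsp.subspace_diff[OF subspace_q assms(1,2)] by auto
  have "x - y \<in> q" using matsp.subspace_diff[OF subspace_q assms(1,2)] .
  then have "\<nu> (x - y + y) = \<nu> (x - y) + \<nu> y" using dualD(1)[OF \<nu>(1)] assms(2) by blast
  then show False using \<nu>(2) assms(3)[OF \<nu>(1)] by simp
qed

lemma differential_eqI:
  assumes "x \<in> q" "\<And>\<nu>. \<nu> \<in> dual_space q \<Longrightarrow> \<nu> x = sym.der f \<eta> \<nu>"
  shows "differential q f \<eta> = x"
  unfolding differential_def
proof (rule the_equality)
  show "x \<in> q \<and> (\<forall>\<nu>\<in>dual_space q. \<nu> x = Polynomial.coeff (as_poly (\<lambda>t. f (\<eta> + fscale t \<nu>))) 1)"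
    using assms by (simp add: sym.der_def sym.line_def)
  fix y assume y: "y \<in> q \<and> (\<forall>\<nu>\<in>dual_space q. \<nu> y = Polynomial.coeff (as_poly (\<lambda>t. f (\<eta> + fscale t \<nu>))) 1)"
  show "y = x"
  proof (rule dual_eqI)
    fix \<nu> assume \<nu>: "\<nu> \<in> dual_space q"
    then show "\<nu> y = \<nu> x"
      using y assms(2)[OF \<nu>] by (simp add: sym.der_def sym.line_def)
  qed (use y assms(1) in auto)
qed

lemma differential_const: "\<eta> \<in> dual_space q \<Longrightarrow> differential q (const_on (dual_space q) c) \<eta> = 0"
  by (rule differential_eqI)
    (simp_all add: matsp.subspace_0[OF subspace_q] sym.der_const dualD(4))

lemma differential_evaluation:
  "x \<in> q \<Longrightarrow> \<eta> \<in> dual_space q \<Longrightarrow> differential q (evaluation q x) \<eta> = x"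
  by (rule differential_eqI) (simp_all add: sym.der_gen evaluation_def)

text \<open>The vector is built along the generation of \<open>f\<close>, by linearity and the
  Leibniz rule, so no coordinates on \<open>q\<close> have to be chosen.\<close>

lemma differential_in_and_dual:
  assumes "f \<in> symmetric_algebra q" "\<eta> \<in> dual_space q"
  shows "differential q f \<eta> \<in> q \<and> (\<forall>\<nu>\<in>dual_space q. \<nu> (differential q f \<eta>) = sym.der f \<eta> \<nu>)"
proof -
  have "\<exists>x\<in>q. \<forall>\<nu>\<in>dual_space q. \<nu> x = sym.der f \<eta> \<nu>"
    using assms(1) unfolding symmetric_algebra_def
  proof induction
    case (const c)
    show ?case
      by (rule bexI[of _ 0])
        (simp_all add: matsp.subspace_0[OF subspace_q] sym.der_const assms(2) dualD(4))
  next
    case (gen f)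
    then obtain x where "x \<in> q" "f = evaluation q x" by blast
    then show ?case
      by (intro bexI[of _ x]) (simp_all add: sym.der_gen assms(2) evaluation_def)
  next
    case (add f g)
    then obtain x y where x: "x \<in> q" "\<forall>\<nu>\<in>dual_space q. \<nu> x = sym.der f \<eta> \<nu>"
      and y: "y \<in> q" "\<forall>\<nu>\<in>dual_space q. \<nu> y = sym.der g \<eta> \<nu>" by blast
    have "\<nu> (x + y) = sym.der (f + g) \<eta> \<nu>" if "\<nu> \<in> dual_space q" for \<nu>
      unfolding sym.der_add[OF add.hyps assms(2) that] using x y that dualD(1)[OF that] by auto
    then show ?case using x y matsp.subspace_add[OF subspace_q] by blast
  next
    case (mult f g)
    then obtain x y where x: "x \<in> q" "\<forall>\<nu>\<in>dual_space q. \<nu> x = sym.der f \<eta> \<nu>"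
      and y: "y \<in> q" "\<forall>\<nu>\<in>dual_space q. \<nu> y = sym.der g \<eta> \<nu>" by blast
    have xy: "mscale (f \<eta>) y \<in> q" "mscale (g \<eta>) x \<in> q"
      using x y matsp.subspace_scale[OF subspace_q] by blast+
    have "\<nu> (mscale (f \<eta>) y + mscale (g \<eta>) x) = sym.der (f * g) \<eta> \<nu>" if "\<nu> \<in> dual_space q" for \<nu>
      unfolding sym.der_mult[OF mult.hyps assms(2) that] dualD(1)[OF that xy]
      using x y that dualD(2)[OF that] by simp
    then show ?case using xy matsp.subspace_add[OF subspace_q] by blast
  qed
  then obtain x where x: "x \<in> q" "\<And>\<nu>. \<nu> \<in> dual_space q \<Longrightarrow> \<nu> x = sym.der f \<eta> \<nu>" by blast
  then have "differential q f \<eta> = x" by (rule differential_eqI)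
  then show ?thesis using x by simp
qed

lemma differential_in: "f \<in> symmetric_algebra q \<Longrightarrow> \<eta> \<in> dual_space q \<Longrightarrow> differential q f \<eta> \<in> q"
  and dual_differential: "f \<in> symmetric_algebra q \<Longrightarrow> \<eta> \<in> dual_space q \<Longrightarrow> \<nu> \<in> dual_space q \<Longrightarrow>
    \<nu> (differential q f \<eta>) = sym.der f \<eta> \<nu>"
  using differential_in_and_dual by blast+

lemma differential_add:
  assumes "f \<in> symmetric_algebra q" "g \<in> symmetric_algebra q" "\<eta> \<in> dual_space q"
  shows "differential q (f + g) \<eta> = differential q f \<eta> + differential q g \<eta>"
proof (rule differential_eqI)
  note d = differential_in[OF assms(1,3)] differential_in[OF assms(2,3)]
  show "differential q f \<eta> + differential q g \<eta> \<in> q"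
    using d matsp.subspace_add[OF subspace_q] by blast
  fix \<nu> assume \<nu>: "\<nu> \<in> dual_space q"
  show "\<nu> (differential q f \<eta> + differential q g \<eta>) = sym.der (f + g) \<eta> \<nu>"
    unfolding dualD(1)[OF \<nu> d] sym.der_add[OF assms(1,2)[unfolded symmetric_algebra_def] assms(3) \<nu>]
    using assms \<nu> by (simp add: dual_differential)
qed

lemma differential_mult:
  assumes "f \<in> symmetric_algebra q" "g \<in> symmetric_algebra q" "\<eta> \<in> dual_space q"
  shows "differential q (f * g) \<eta> = mscale (f \<eta>) (differential q g \<eta>) + mscale (g \<eta>) (differential q f \<eta>)"
proof (rule differential_eqI)
  note d = differential_in[OF assms(1,3)] differential_in[OF assms(2,3)]
  have d': "mscale (f \<eta>) (differential q g \<eta>) \<in> q" "mscale (g \<eta>) (differential q f \<eta>) \<in> q"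
    using d matsp.subspace_scale[OF subspace_q] by blast+
  show "mscale (f \<eta>) (differential q g \<eta>) + mscale (g \<eta>) (differential q f \<eta>) \<in> q"
    using d' matsp.subspace_add[OF subspace_q] by blast
  fix \<nu> assume \<nu>: "\<nu> \<in> dual_space q"
  show "\<nu> (mscale (f \<eta>) (differential q g \<eta>) + mscale (g \<eta>) (differential q f \<eta>)) = sym.der (f * g) \<eta> \<nu>"
    unfolding dualD(1)[OF \<nu> d'] sym.der_mult[OF assms(1,2)[unfolded symmetric_algebra_def] assms(3) \<nu>]
    using assms \<nu> d by (simp add: dual_differential dualD(2)[OF \<nu>])
qed

text \<open>By the Leibniz rule, the differential of a product at a fixed point is a combination of
  those of the factors, and constants contribute zero: passing from generators to the algebra adds
  nothing.\<close>

lemma span_differentials_generated_algebra: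
  assumes H: "H \<subseteq> symmetric_algebra q" and \<eta>: "\<eta> \<in> dual_space q"
  shows "matsp.span {differential q f \<eta> | f. f \<in> generated_algebra (dual_space q) H}
    = matsp.span {differential q f \<eta> | f. f \<in> H}"
proof -
  let ?U = "matsp.span {differential q f \<eta> | f. f \<in> H}"
  have "f \<in> symmetric_algebra q \<and> differential q f \<eta> \<in> ?U"
    if "f \<in> generated_algebra (dual_space q) H" for f
    using that
  proof induction
    case (const c)
    then show ?case
      by (simp add: differential_const \<eta> symmetric_algebra_def generated_algebra.const matsp.span_zero)
  next
    case (gen f)
    then show ?case using H by (auto intro: matsp.span_base)
  next
    case (add f g)
    then have "f + g \<in> symmetric_algebra q"
      unfolding symmetric_algebra_def by (intro generated_algebra.add) auto
    moreover have "differential q (f + g) \<eta> \<in> ?U"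
      unfolding differential_add[OF conjunct1[OF add.IH(1)] conjunct1[OF add.IH(2)] \<eta>]
      by (intro matsp.span_add conjunct2[OF add.IH(1)] conjunct2[OF add.IH(2)])
    ultimately show ?case ..
  next
    case (mult f g)
    then have "f * g \<in> symmetric_algebra q"
      unfolding symmetric_algebra_def by (intro generated_algebra.mult) auto
    moreover have "differential q (f * g) \<eta> \<in> ?U"
      unfolding differential_mult[OF conjunct1[OF mult.IH(1)] conjunct1[OF mult.IH(2)] \<eta>]
      by (intro matsp.span_add matsp.span_scale conjunct2[OF mult.IH(1)] conjunct2[OF mult.IH(2)])
    ultimately show ?case ..
  qed
  then have "{differential q f \<eta> | f. f \<in> generated_algebra (dual_space q) H} \<subseteq> ?U" by blast
  moreover have "{differential q f \<eta> | f. f \<in> H}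
      \<subseteq> {differential q f \<eta> | f. f \<in> generated_algebra (dual_space q) H}"
    using generated_algebra.gen by blast
  ultimately show ?thesis
    by (intro subset_antisym matsp.span_minimal matsp.span_mono matsp.subspace_span)
qed

text \<open>It is enough to bracket with the linear functions \<open>evaluation q y\<close>, whose
  differential is \<open>y\<close> everywhere.\<close>

lemma differential_centre_in_stabiliser:
  assumes f: "f \<in> poisson_centre q" and \<eta>: "\<eta> \<in> dual_space q"
  shows "differential q f \<eta> \<in> stabiliser q \<eta>"
proof -
  have fS: "f \<in> symmetric_algebra q" using f by (simp add: poisson_centre_def)
  have "\<eta> (lie_bracket (differential q f \<eta>) y) = 0" if y: "y \<in> q" for y
  proof -
    have "evaluation q y \<in> symmetric_algebra q"
      unfolding symmetric_algebra_def using y by (blast intro: generated_algebra.gen)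
    then have "poisson_bracket q f (evaluation q y) = 0" using f by (simp add: poisson_centre_def)
    then have "poisson_bracket q f (evaluation q y) \<eta> = 0" by simp
    then show ?thesis using \<eta> y by (simp add: poisson_bracket_def differential_evaluation)
  qed
  then show ?thesis using differential_in[OF fS \<eta>] by (simp add: stabiliser_def)
qed

lemma centreI:
  assumes f: "f \<in> symmetric_algebra q"
    and st: "\<And>\<eta>. \<eta> \<in> dual_space q \<Longrightarrow> differential q f \<eta> \<in> stabiliser q \<eta>"
  shows "f \<in> poisson_centre q"
proof -
  have "poisson_bracket q f g = 0" if g: "g \<in> symmetric_algebra q" for g
  proof
    fix \<eta> show "poisson_bracket q f g \<eta> = 0 \<eta>"
      using st[of \<eta>] differential_in[OF g, of \<eta>] by (simp add: poisson_bracket_def stabiliser_def)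
  qed
  then show ?thesis using f by (simp add: poisson_centre_def)
qed

text \<open>Functions are represented by zero outside the dual space, and dilations must respect
  this; the factor 0 would map every point into the dual space.\<close>

lemma dual_scale_iff:
  assumes "c \<noteq> 0"
  shows "fscale c \<eta> \<in> dual_space q \<longleftrightarrow> \<eta> \<in> dual_space q"
proof
  assume "fscale c \<eta> \<in> dual_space q"
  then have "fscale (1 / c) (fscale c \<eta>) \<in> dual_space q"
    by (rule funsp.subspace_scale[OF subspace_dual_space])
  then show "\<eta> \<in> dual_space q" using assms by simp
qed (rule funsp.subspace_scale[OF subspace_dual_space])

lemma dilate_in_symmetric_algebra:
  assumes c: "c \<noteq> 0" and f: "f \<in> symmetric_algebra q"
  shows "(\<lambda>\<eta>. f (fscale c \<eta>)) \<in> symmetric_algebra q"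
  using f unfolding symmetric_algebra_def
proof induction
  case (const d)
  have "(\<lambda>\<eta>. const_on (dual_space q) d (fscale c \<eta>)) = const_on (dual_space q) d"
    by (simp add: const_on_def dual_scale_iff[OF c])
  then show ?case by (simp add: generated_algebra.const)
next
  case (gen f)
  then obtain x where x: "x \<in> q" "f = evaluation q x" by blast
  have "(\<lambda>\<eta>. f (fscale c \<eta>)) = const_on (dual_space q) c * f"
  proof
    fix \<eta>
    have "fscale c \<eta> x = c * \<eta> x" by (simp add: fscale_def)
    then show "f (fscale c \<eta>) = (const_on (dual_space q) c * f) \<eta>"
      by (simp add: x const_on_def evaluation_def dual_scale_iff[OF c])
  qed
  moreover have "\<dots> \<in> generated_algebra (dual_space q) (evaluation q ` q)"
    using gen by (intro generated_algebra.intros)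
  ultimately show ?case by simp
next
  case (add f g)
  then show ?case using generated_algebra.add[OF add.IH] by (simp add: plus_fun_def)
next
  case (mult f g)
  then show ?case using generated_algebra.mult[OF mult.IH] by (simp add: times_fun_def)
qed

lemma differential_dilate:
  assumes c: "c \<noteq> 0" and f: "f \<in> symmetric_algebra q" and \<eta>: "\<eta> \<in> dual_space q"
  shows "differential q (\<lambda>\<eta>. f (fscale c \<eta>)) \<eta> = mscale c (differential q f (fscale c \<eta>))"
proof (rule differential_eqI)
  have c\<eta>: "fscale c \<eta> \<in> dual_space q" using \<eta> dual_scale_iff[OF c] by simp
  note d = differential_in[OF f c\<eta>]
  show "mscale c (differential q f (fscale c \<eta>)) \<in> q" by (rule matsp.subspace_scale[OF subspace_q d])
  fix \<nu> assume \<nu>: "\<nu> \<in> dual_space q"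
  have "fscale c (\<eta> + fscale t \<nu>) = fscale c \<eta> + fscale t (fscale c \<nu>)" for t
    by (simp add: fscale_def fun_eq_iff algebra_simps)
  then have "sym.der (\<lambda>\<eta>. f (fscale c \<eta>)) \<eta> \<nu> = sym.der f (fscale c \<eta>) (fscale c \<nu>)"
    by (simp only: sym.der_def sym.line_def)
  also have "\<dots> = c * sym.der f (fscale c \<eta>) \<nu>"
    by (rule sym.der_scale_direction[OF f[unfolded symmetric_algebra_def] c\<eta> \<nu>])
  finally show "\<nu> (mscale c (differential q f (fscale c \<eta>))) = sym.der (\<lambda>\<eta>. f (fscale c \<eta>)) \<eta> \<nu>"
    by (simp add: dualD(2)[OF \<nu> d] dual_differential[OF f c\<eta> \<nu>])
qed

text \<open>The differential of the dilated function at \<eta> is a multiple of the one at c \<eta>,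
  and both points have the same stabiliser. This takes the place of splitting \<open>f\<close> into
  homogeneous parts.\<close>

lemma dilate_in_centre:
  assumes c: "c \<noteq> 0" and f: "f \<in> poisson_centre q"
  shows "(\<lambda>\<eta>. f (fscale c \<eta>)) \<in> poisson_centre q"
proof (rule centreI)
  have fS: "f \<in> symmetric_algebra q" using f by (simp add: poisson_centre_def)
  show "(\<lambda>\<eta>. f (fscale c \<eta>)) \<in> symmetric_algebra q" by (rule dilate_in_symmetric_algebra[OF c fS])
  fix \<eta> assume \<eta>: "\<eta> \<in> dual_space q"
  have c\<eta>: "fscale c \<eta> \<in> dual_space q" using \<eta> dual_scale_iff[OF c] by simp
  let ?x = "differential q f (fscale c \<eta>)"
  have x: "?x \<in> q" "\<And>y. y \<in> q \<Longrightarrow> c * \<eta> (lie_bracket ?x y) = 0"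
    using differential_centre_in_stabiliser[OF f c\<eta>] by (auto simp: stabiliser_def fscale_def)
  have cx: "mscale c ?x \<in> q" by (rule matsp.subspace_scale[OF subspace_q x(1)])
  have "\<eta> (lie_bracket (mscale c ?x) y) = 0" if y: "y \<in> q" for y
  proof -
    have eq: "lie_bracket (mscale c ?x) y = mscale c (lie_bracket ?x y)"
      by (simp add: lie_bracket_def mscale_def vec_eq_iff matrix_matrix_mult_def sum_distrib_left
          right_diff_distrib algebra_simps)
    show ?thesis
    \<comment> \<open>In this locale \<open>q\<close> is just a subspace, so a bracket may leave it;
      there \<eta> takes its default value 0.\<close>
    proof (cases "lie_bracket ?x y \<in> q")
      case True
      show ?thesis unfolding eq dualD(2)[OF \<eta> True] by (rule x(2)[OF y])
    next
      case False
      then have "mscale c (lie_bracket ?x y) \<notin> q"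
        using matsp.subspace_scale[OF subspace_q, of "mscale c (lie_bracket ?x y)" "1 / c"] c by auto
      then show ?thesis unfolding eq by (rule dualD(3)[OF \<eta>])
    qed
  qed
  then show "differential q (\<lambda>\<eta>. f (fscale c \<eta>)) \<eta> \<in> stabiliser q \<eta>"
    unfolding differential_dilate[OF c fS \<eta>] stabiliser_def using cx by simp
qed

section \<open>Degrees, shifts and the expansion of differentials\<close>

lemma degree_le_ex:
  assumes "f \<in> symmetric_algebra q"
  shows "\<exists>d. degree_le q d f"
  using assms unfolding symmetric_algebra_def
proof induction
  case (add f g)
  then obtain d e where "degree_le q d f" "degree_le q e g" by blast
  then have "degree_le q (max d e) f" "degree_le q (max d e) g"
    by (auto intro: degree_le.mono)
  then show ?case using degree_le.add by blast
qed (blast intro: degree_le.intros)+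

lemma degree_le_poly_degree: "f \<in> symmetric_algebra q \<Longrightarrow> degree_le q (poly_degree q f) f"
  unfolding poly_degree_def using degree_le_ex by (rule LeastI_ex)

lemma shift_eq:
  "shift q \<xi> f j = (\<lambda>\<mu>. if \<mu> \<in> dual_space q then Polynomial.coeff (sym.line f \<mu> \<xi>) j else 0)"
  unfolding shift_def sym.line_def ..

text \<open>The point is that the coefficient at \<open>d\<close> is the same for all base points
  \<mu>: the shift with index \<open>d\<close> is constant, which is why shifts stop below the
  degree.\<close>

lemma degree_le_line:
  assumes "degree_le q d f" "\<xi> \<in> dual_space q"
  shows "f \<in> symmetric_algebra q \<and> (\<exists>c. \<forall>\<mu>\<in>dual_space q.
    Polynomial.degree (sym.line f \<mu> \<xi>) \<le> d \<and> Polynomial.coeff (sym.line f \<mu> \<xi>) d = c)"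
  using assms(1)
proof induction
  case (const c)
  then show ?case
    using assms(2) by (auto simp: symmetric_algebra_def sym.line_const intro: generated_algebra.const)
next
  case (linear x)
  then have g: "evaluation q x \<in> evaluation q ` q" by blast
  then have "evaluation q x \<in> symmetric_algebra q"
    unfolding symmetric_algebra_def by (rule generated_algebra.gen)
  then show ?case using sym.line_gen[OF g _ assms(2)] by simp
next
  case (mono d f e)
  then obtain c where c: "\<forall>\<mu>\<in>dual_space q.
      Polynomial.degree (sym.line f \<mu> \<xi>) \<le> d \<and> Polynomial.coeff (sym.line f \<mu> \<xi>) d = c" by blast
  have "\<forall>\<mu>\<in>dual_space q. Polynomial.degree (sym.line f \<mu> \<xi>) \<le> e
      \<and> Polynomial.coeff (sym.line f \<mu> \<xi>) e = (if d = e then c else 0)"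
    using c mono.hyps(2) by (auto intro!: Polynomial.coeff_eq_0 intro: order_trans le_less_trans[of _ d e])
  then show ?case using mono.IH by blast
next
  case (add d f g)
  then obtain b c where b: "\<forall>\<mu>\<in>dual_space q.
      Polynomial.degree (sym.line f \<mu> \<xi>) \<le> d \<and> Polynomial.coeff (sym.line f \<mu> \<xi>) d = b"
    and c: "\<forall>\<mu>\<in>dual_space q.
      Polynomial.degree (sym.line g \<mu> \<xi>) \<le> d \<and> Polynomial.coeff (sym.line g \<mu> \<xi>) d = c" by blast
  have fg: "f \<in> sym.polys" "g \<in> sym.polys" using add.IH by (auto simp: symmetric_algebra_def)
  have "\<forall>\<mu>\<in>dual_space q. Polynomial.degree (sym.line (f + g) \<mu> \<xi>) \<le> d
      \<and> Polynomial.coeff (sym.line (f + g) \<mu> \<xi>) d = b + c"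
  proof
    fix \<mu> assume \<mu>: "\<mu> \<in> dual_space q"
    show "Polynomial.degree (sym.line (f + g) \<mu> \<xi>) \<le> d \<and> Polynomial.coeff (sym.line (f + g) \<mu> \<xi>) d = b + c"
      unfolding sym.line_add[OF fg \<mu> assms(2)] using b c \<mu> by (auto intro: degree_add_le)
  qed
  moreover have "f + g \<in> symmetric_algebra q"
    using fg unfolding symmetric_algebra_def by (rule generated_algebra.add)
  ultimately show ?case by blast
next
  case (mult d f e g)
  then obtain b c where b: "\<forall>\<mu>\<in>dual_space q.
      Polynomial.degree (sym.line f \<mu> \<xi>) \<le> d \<and> Polynomial.coeff (sym.line f \<mu> \<xi>) d = b"
    and c: "\<forall>\<mu>\<in>dual_space q.
      Polynomial.degree (sym.line g \<mu> \<xi>) \<le> e \<and> Polynomial.coeff (sym.line g \<mu> \<xi>) e = c" by blast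
  have fg: "f \<in> sym.polys" "g \<in> sym.polys" using mult.IH by (auto simp: symmetric_algebra_def)
  have "\<forall>\<mu>\<in>dual_space q. Polynomial.degree (sym.line (f * g) \<mu> \<xi>) \<le> d + e
      \<and> Polynomial.coeff (sym.line (f * g) \<mu> \<xi>) (d + e) = b * c"
  proof
    fix \<mu> assume \<mu>: "\<mu> \<in> dual_space q"
    show "Polynomial.degree (sym.line (f * g) \<mu> \<xi>) \<le> d + e
        \<and> Polynomial.coeff (sym.line (f * g) \<mu> \<xi>) (d + e) = b * c"
      unfolding sym.line_mult[OF fg \<mu> assms(2)]
      using b c \<mu> by (auto simp: coeff_mult_degree_le intro: order_trans[OF degree_mult_le] add_mono)
  qed
  moreover have "f * g \<in> symmetric_algebra q"
    using fg unfolding symmetric_algebra_def by (rule generated_algebra.mult)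
  ultimately show ?case by blast
qed

lemma shift_in_symmetric_algebra:
  assumes f: "f \<in> symmetric_algebra q" and \<xi>: "\<xi> \<in> dual_space q"
  shows "shift q \<xi> f j \<in> symmetric_algebra q"
  using f unfolding symmetric_algebra_def
proof (induction arbitrary: j)
  case (const c)
  have "shift q \<xi> (const_on (dual_space q) c) j = const_on (dual_space q) (Polynomial.coeff [:c:] j)"
    using \<xi> by (auto simp: shift_eq const_on_def fun_eq_iff sym.line_const[unfolded const_on_def])
  then show ?case by (simp add: generated_algebra.const)
next
  case (gen f)
  then obtain x where x: "x \<in> q" "f = evaluation q x" by blast
  consider "j = 0" | "j = 1" | "j > 1" by linarith
  then show ?case
  proof cases
    case 1
    have "shift q \<xi> f j = f"
      using gen \<xi> 1 by (auto simp: shift_eq fun_eq_iff sym.line_gen x(2) evaluation_def)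
    then show ?thesis using gen by (simp add: generated_algebra.gen)
  next
    case 2
    have "shift q \<xi> f j = const_on (dual_space q) (f \<xi>)"
      using gen \<xi> 2 by (auto simp: shift_eq fun_eq_iff sym.line_gen const_on_def)
    then show ?thesis by (simp add: generated_algebra.const)
  next
    case 3
    have "shift q \<xi> f j = const_on (dual_space q) 0"
      using gen \<xi> 3 by (auto simp: shift_eq fun_eq_iff sym.line_gen const_on_def Polynomial.coeff_eq_0)
    then show ?thesis by (simp add: generated_algebra.const)
  qed
next
  case (add f g)
  have "shift q \<xi> (f + g) j = shift q \<xi> f j + shift q \<xi> g j"
  proof
    fix \<mu>
    show "shift q \<xi> (f + g) j \<mu> = (shift q \<xi> f j + shift q \<xi> g j) \<mu>"
      using sym.line_add[OF add.hyps, of \<mu> \<xi>] \<xi> unfolding shift_eq plus_fun_apply by auto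
  qed
  then show ?case using generated_algebra.add[OF add.IH] by metis
next
  case (mult f g)
  have "shift q \<xi> (f * g) j = (\<Sum>i\<le>j. shift q \<xi> f i * shift q \<xi> g (j - i))"
  proof
    fix \<mu>
    have sum_apply: "(\<Sum>i\<in>I. h i) \<mu> = (\<Sum>i\<in>I. h i \<mu>)" for h :: "nat \<Rightarrow> ('k^'n^'n \<Rightarrow> 'k) \<Rightarrow> 'k" and I
      by (induction I rule: infinite_finite_induct) auto
    show "shift q \<xi> (f * g) j \<mu> = (\<Sum>i\<le>j. shift q \<xi> f i * shift q \<xi> g (j - i)) \<mu>"
      using sym.line_mult[OF mult.hyps, of \<mu> \<xi>] \<xi>
      unfolding shift_eq sum_apply times_fun_apply by (auto simp: Polynomial.coeff_mult)
  qed
  moreover have "\<dots> \<in> sym.polys"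
    using mult.IH by (intro sym.polys_sum generated_algebra.mult)
  ultimately show ?case by metis
qed

text \<open>Expand f(\<mu> + a \<xi> + t \<nu>) in powers of a from the base point \<mu> + t \<nu>,
  then compare the coefficients of t. The bound \<open>d\<close> need not be the exact
  degree.\<close>

lemma differential_shifted:
  assumes f: "degree_le q d f" and \<mu>: "\<mu> \<in> dual_space q" and \<xi>: "\<xi> \<in> dual_space q"
  shows "differential q f (\<mu> + fscale a \<xi>) = (\<Sum>j<d. mscale (a ^ j) (differential q (shift q \<xi> f j) \<mu>))"
proof -
  obtain c where fS: "f \<in> symmetric_algebra q" and c: "\<And>\<mu>. \<mu> \<in> dual_space q \<Longrightarrow>
      Polynomial.degree (sym.line f \<mu> \<xi>) \<le> d \<and> Polynomial.coeff (sym.line f \<mu> \<xi>) d = c"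
    using degree_le_line[OF f \<xi>] by blast
  have fP: "f \<in> sym.polys" using fS by (simp add: symmetric_algebra_def)
  have sS: "shift q \<xi> f j \<in> symmetric_algebra q" for j by (rule shift_in_symmetric_algebra[OF fS \<xi>])
  have sP: "shift q \<xi> f j \<in> sym.polys" for j using sS by (simp add: symmetric_algebra_def)
  \<comment> \<open>The term j = d drops out, so the range j < d is the one in the definition of
    \<open>shift_algebra\<close>.\<close>
  have top: "differential q (shift q \<xi> f d) \<mu> = 0"
  proof -
    have "shift q \<xi> f d = const_on (dual_space q) c" using c by (auto simp: shift_eq const_on_def)
    then show ?thesis using differential_const[OF \<mu>] by simp
  qed
  have "differential q f (\<mu> + fscale a \<xi>) = (\<Sum>j\<le>d. mscale (a ^ j) (differential q (shift q \<xi> f j) \<mu>))"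
  proof (rule differential_eqI)
    have d_in: "differential q (shift q \<xi> f j) \<mu> \<in> q" for j by (rule differential_in[OF sS \<mu>])
    show "(\<Sum>j\<le>d. mscale (a ^ j) (differential q (shift q \<xi> f j) \<mu>)) \<in> q"
      by (intro matsp.subspace_sum matsp.subspace_scale subspace_q d_in)
    fix \<nu> assume \<nu>: "\<nu> \<in> dual_space q"
    have "sym.line f (\<mu> + fscale a \<xi>) \<nu> = (\<Sum>j\<le>d. Polynomial.smult (a ^ j) (sym.line (shift q \<xi> f j) \<mu> \<nu>))"
    proof (rule sym.line_eqI)
      fix t
      have \<mu>t: "\<mu> + fscale t \<nu> \<in> dual_space q" by (rule dual_add_scale[OF \<mu> \<nu>])
      have "f (\<mu> + fscale a \<xi> + fscale t \<nu>) = f (\<mu> + fscale t \<nu> + fscale a \<xi>)"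
        by (simp only: add.assoc add.commute[of "fscale a \<xi>"])
      also have "\<dots> = poly (sym.line f (\<mu> + fscale t \<nu>) \<xi>) a"
        by (rule sym.poly_line[OF fP \<mu>t \<xi>, symmetric])
      also have "\<dots> = (\<Sum>j\<le>d. Polynomial.coeff (sym.line f (\<mu> + fscale t \<nu>) \<xi>) j * a ^ j)"
        using c[OF \<mu>t] by (intro poly_sum_le) blast
      also have "\<dots> = (\<Sum>j\<le>d. shift q \<xi> f j (\<mu> + fscale t \<nu>) * a ^ j)"
        unfolding shift_eq using \<mu>t by simp
      also have "\<dots> = (\<Sum>j\<le>d. a ^ j * poly (sym.line (shift q \<xi> f j) \<mu> \<nu>) t)"
        by (simp only: sym.poly_line[OF sP \<mu> \<nu>] mult.commute)
      finally show "poly (\<Sum>j\<le>d. Polynomial.smult (a ^ j) (sym.line (shift q \<xi> f j) \<mu> \<nu>)) t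
          = f (\<mu> + fscale a \<xi> + fscale t \<nu>)"
        by (simp only: poly_sum poly_smult)
    qed
    then show "\<nu> (\<Sum>j\<le>d. mscale (a ^ j) (differential q (shift q \<xi> f j) \<mu>)) = sym.der f (\<mu> + fscale a \<xi>) \<nu>"
      unfolding dual_sum[OF \<nu> d_in] sym.der_def
      by (simp add: Polynomial.coeff_sum dual_differential[OF sS \<mu> \<nu>] sym.der_def)
  qed
  also have "\<dots> = (\<Sum>j<d. mscale (a ^ j) (differential q (shift q \<xi> f j) \<mu>))"
    using top by (simp add: lessThan_Suc_atMost[symmetric])
  finally show ?thesis .
qed

lemma poly_curve_differential:
  assumes f: "f \<in> symmetric_algebra q" and \<mu>: "\<mu> \<in> dual_space q" and \<xi>: "\<xi> \<in> dual_space q"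
  shows "matsp.poly_curve (\<lambda>t. differential q f (\<mu> + fscale t \<xi>))"
  unfolding matsp.poly_curve_def
proof (intro allI impI)
  fix \<phi> :: "'k^'n^'n \<Rightarrow> 'k" assume \<phi>: "matsp.functional \<phi>"
  obtain d where d: "degree_le q d f" using degree_le_ex[OF f] by blast
  have "poly (\<Sum>j<d. Polynomial.monom (\<phi> (differential q (shift q \<xi> f j) \<mu>)) j) t
      = \<phi> (differential q f (\<mu> + fscale t \<xi>))" for t
    unfolding differential_shifted[OF d \<mu> \<xi>]
    by (simp add: matsp.functional_simps[OF \<phi>] poly_sum poly_monom mult.commute)
  then show "\<exists>p. \<forall>t. poly p t = \<phi> (differential q f (\<mu> + fscale t \<xi>))" by blast
qed

end

section \<open>Differentials along a regular plane\<close>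

text \<open>Stated without finite dimension, since it is applied to a plane inside a space of
  functions. That \<open>B\<close> is finite and non-empty makes the dimension positive, which rules
  out an infinite basis \<open>C\<close>, whose \<open>card\<close> would be 0.\<close>

lemma (in vector_space) span_independent_of_card_dim:
  assumes B: "independent B" "B \<subseteq> V" "finite B" "card B = dim V" "B \<noteq> {}"
  shows "V \<subseteq> span B"
proof
  fix x assume x: "x \<in> V"
  obtain C where C: "C \<subseteq> V" "independent C" "V \<subseteq> span C" "card C = dim V"
    by (rule basis_exists) (rule that)
  have "card C > 0" unfolding C(4) B(4)[symmetric] using B(3,5) by (simp add: card_gt_0_iff)
  then have fin: "finite C" by (rule card_ge_0_finite)
  show "x \<in> span B"
  proof (rule ccontr)
    assume nx: "x \<notin> span B"
    then have "independent (insert x B)" using B(1) by (rule independent_insertI)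
    moreover have "insert x B \<subseteq> span C" using x B(2) C(3) by blast
    ultimately have "card (insert x B) \<le> card C"
      using independent_span_bound[OF fin] by blast
    moreover have "x \<notin> B" using nx span_base by blast
    ultimately show False using B(3,4) C(4) by simp
  qed
qed

lemma lie_bracket_linear:
  "lie_bracket (x + x') y = lie_bracket x y + lie_bracket x' y"
  "lie_bracket x (y + y') = lie_bracket x y + lie_bracket x y'"
  "lie_bracket (mscale c x) y = mscale c (lie_bracket x y)"
  "lie_bracket x (mscale c y) = mscale c (lie_bracket x y)"
  "lie_bracket x y = - lie_bracket y x"
  by (simp_all add: lie_bracket_def mscale_def vec_eq_iff matrix_matrix_mult_def algebra_simps
      sum.distrib sum_distrib_left)

lemma bilinear_form_lie_bracket:
  assumes "matsp.functional \<phi>"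
  shows "matsp.bilinear_form (\<lambda>x y. \<phi> (lie_bracket x y))"
  using assms unfolding matsp.bilinear_form_def matsp.functional_iff
  by (simp add: lie_bracket_linear(1-4))

lemma (in matrix_subspace) dual_extension:
  assumes "\<nu> \<in> dual_space q"
  obtains \<phi> where "matsp.functional \<phi>" "\<And>x. x \<in> q \<Longrightarrow> \<phi> x = \<nu> x"
proof (rule matsp.extend_functional[OF subspace_q])
  show "\<nu> (x + y) = \<nu> x + \<nu> y" if "x \<in> q" "y \<in> q" for x y
    using that by (rule dualD(1)[OF assms])
  show "\<nu> (mscale c x) = c * \<nu> x" if "x \<in> q" for c x
    using that by (rule dualD(2)[OF assms])
qed (rule that)

lemma (in matrix_subspace) dim_differentials_dilate_le:
  assumes c: "c \<noteq> 0" and \<mu>: "\<mu> \<in> dual_space q"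
  shows "matsp.dim {differential q f (fscale c \<mu>) | f. f \<in> poisson_centre q}
    \<le> matsp.dim {differential q f \<mu> | f. f \<in> poisson_centre q}"
proof -
  interpret fd: finite_dimensional_vector_space "mscale :: 'k \<Rightarrow> 'k^'n^'n \<Rightarrow> 'k^'n^'n" "matsp.extend_basis {}"
    by (rule finite_dimensional_mscale)
  have "differential q f (fscale c \<mu>) \<in> matsp.span {differential q f \<mu> | f. f \<in> poisson_centre q}"
    if f: "f \<in> poisson_centre q" for f
  proof -
    have fS: "f \<in> symmetric_algebra q" using f by (simp add: poisson_centre_def)
    have "differential q f (fscale c \<mu>) = mscale (1 / c) (differential q (\<lambda>\<eta>. f (fscale c \<eta>)) \<mu>)"
      unfolding differential_dilate[OF c fS \<mu>] using c by simp
    then show ?thesis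
      using dilate_in_centre[OF c f] by (auto intro: matsp.span_scale matsp.span_base)
  qed
  then show ?thesis by (intro fd.dim_mono) blast
qed

theorem theorem2p4:
  fixes Q q :: "('k::{alg_closed_field, field_char_0}^'n^'n) set"
    and P :: "('k^'n^'n \<Rightarrow> 'k) set"
  assumes "connected_algebraic_group Q"
    and "q = lie_algebra Q"
    and "codim_property 2 q"
    and "trdeg (dual_space q) (poisson_centre q) = ind q"
    and "P \<subseteq> dual_space q" and "funsp.subspace P" and "funsp.dim P = 2"
    and "P - {0} \<subseteq> regular_set q"
    and "\<exists>\<xi>0\<in>P. matsp.dim (matsp.span {differential q f \<xi>0 | f. f \<in> poisson_centre q}) = ind q"
    and "\<xi> \<in> P" and "\<eta> \<in> P" and "\<xi> \<noteq> \<eta>" and "funsp.independent {\<xi>, \<eta>}"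
  shows "real (matsp.dim (matsp.span
      {differential q f \<eta> | f. f \<in> shift_algebra q \<xi> (poisson_centre q)})) = b_invariant q"
proof -
  have sub: "matsp.subspace q" unfolding assms(2) by (rule subspace_lie_algebra)
  have bracket: "lie_bracket x y \<in> q" if "x \<in> q" "y \<in> q" for x y
    using that lie_bracket_in_lie_algebra[of Q x y] assms(1)
    unfolding assms(2) connected_algebraic_group_def algebraic_group_def by blast
  interpret matrix_subspace q using sub by unfold_locales
  interpret fd: finite_dimensional_vector_space "mscale :: 'k \<Rightarrow> 'k^'n^'n \<Rightarrow> 'k^'n^'n" "matsp.extend_basis {}"
    by (rule finite_dimensional_mscale)
  interpret fd: alg_closed_vector_space "mscale :: 'k \<Rightarrow> 'k^'n^'n \<Rightarrow> 'k^'n^'n" "matsp.extend_basis {}" ..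
  have \<xi>: "\<xi> \<in> dual_space q" and \<eta>: "\<eta> \<in> dual_space q" using assms(5,10,11) by blast+
  obtain \<xi>' where \<xi>': "matsp.functional \<xi>'" "\<And>x. x \<in> q \<Longrightarrow> \<xi>' x = \<xi> x"
    by (rule dual_extension[OF \<xi>]) (rule that)
  obtain \<eta>' where \<eta>': "matsp.functional \<eta>'" "\<And>x. x \<in> q \<Longrightarrow> \<eta>' x = \<eta> x"
    by (rule dual_extension[OF \<eta>]) (rule that)
  \<comment> \<open>With \<eta> giving \<open>A\<close> and \<xi> giving \<open>B\<close>, the form
    with coefficients (1, a) belongs to \<eta> + a \<xi>.\<close>
  define A where "A x y = \<eta>' (lie_bracket x y)" for x y
  define B where "B x y = \<xi>' (lie_bracket x y)" for x y
  have A: "matsp.bilinear_form A" and B: "matsp.bilinear_form B"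
    unfolding A_def[abs_def] B_def[abs_def] using \<xi>' \<eta>' by (auto intro: bilinear_form_lie_bracket)
  have skew: "A x y = - A y x" "B x y = - B y x" for x y
    unfolding A_def B_def
    by (metis lie_bracket_linear(5) matsp.functional_simps(4) \<eta>'(1),
        metis lie_bracket_linear(5) matsp.functional_simps(4) \<xi>'(1))
  define pt where "pt s t = fscale s \<eta> + fscale t \<xi>" for s t
  have ptP: "pt s t \<in> P" for s t
    unfolding pt_def using assms(6,10,11) by (intro funsp.subspace_add funsp.subspace_scale)
  then have pt_dual: "pt s t \<in> dual_space q" for s t using assms(5) by blast
  define ker where "ker s t = {x\<in>q. \<forall>y\<in>q. s * A x y + t * B x y = 0}" for s t
  \<comment> \<open>The extended functionals agree with \<xi> and \<eta> on \<open>q\<close> only,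
    so closure of \<open>q\<close> under the bracket is essential here.\<close>
  have stab: "stabiliser q (pt s t) = ker s t" for s t
    unfolding stabiliser_def ker_def A_def B_def
  proof (intro Collect_cong conj_cong refl ball_cong)
    fix x y assume "x \<in> q" "y \<in> q"
    then show "pt s t (lie_bracket x y) = 0 \<longleftrightarrow>
        s * \<eta>' (lie_bracket x y) + t * \<xi>' (lie_bracket x y) = 0"
      using \<xi>'(2) \<eta>'(2) bracket by (simp add: pt_def fscale_def)
  qed
  have ker_sub: "matsp.subspace (ker s t)" for s t
    unfolding ker_def
    by (rule fd.subspace_functional_kernel[OF sub])
      (rule matsp.bilinear_formD(2)[OF matsp.bilinear_form_comb[OF A B]])
  have pt_nz: "pt s t \<noteq> 0" if "(s, t) \<noteq> (0, 0)" for s t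
  proof
    assume "pt s t = 0"
    then have "(\<Sum>v\<in>{\<xi>, \<eta>}. fscale (if v = \<eta> then s else t) v) = 0"
      using assms(12) by (simp add: pt_def add.commute)
    then have "(if v = \<eta> then s else t) = 0" if "v \<in> {\<xi>, \<eta>}" for v
      using funsp.independentD[OF assms(13), of "{\<xi>, \<eta>}" "\<lambda>v. if v = \<eta> then s else t" v] that by simp
    from this[of \<xi>] this[of \<eta>] show False using that assms(12) by simp
  qed
  have rank: "matsp.dim (ker s t) = ind q" if "(s, t) \<noteq> (0, 0)" for s t
    using assms(8) ptP[of s t] pt_nz[OF that] stab[of s t] unfolding regular_set_def by auto
  have P_pt: "\<exists>s t. \<zeta> = pt s t" if "\<zeta> \<in> P" for \<zeta>
  proof -
    have "P \<subseteq> funsp.span {\<xi>, \<eta>}"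
      by (rule funsp.span_independent_of_card_dim) (use assms in auto)
    then have "\<zeta> \<in> funsp.span {\<xi>, \<eta>}" using that by blast
    then obtain t s where "\<zeta> - fscale t \<xi> - fscale s \<eta> = 0"
      unfolding funsp.span_breakdown_eq funsp.span_empty by blast
    then have "\<zeta> = pt s t" unfolding pt_def by (metis add.commute diff_diff_eq eq_iff_diff_eq_0)
    then show ?thesis by blast
  qed

  define W where "W \<mu> = {differential q f \<mu> | f. f \<in> poisson_centre q}" for \<mu>
  have Z_sym: "f \<in> symmetric_algebra q" if "f \<in> poisson_centre q" for f
    using that by (simp add: poisson_centre_def)
  have W_ker: "W (pt s t) \<subseteq> ker s t" for s t
    unfolding W_def using differential_centre_in_stabiliser[OF _ pt_dual] stab by auto
  have generic: "finite {t. matsp.dim (W (\<mu> + fscale t \<nu>)) < matsp.dim (W (\<mu> + fscale t0 \<nu>))}"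
    if "\<mu> \<in> dual_space q" "\<nu> \<in> dual_space q" for \<mu> \<nu> t0
    unfolding W_def by (rule fd.generic_dim) (rule poly_curve_differential[OF Z_sym that])
  have inf: "infinite (UNIV :: 'k set)" by (rule infinite_UNIV_char_0)
  \<comment> \<open>\<open>\<xi>0\<close> may be a multiple of \<open>\<xi>\<close>; then it has to be moved off the line of \<open>\<xi>\<close> before it can be
      scaled into \<open>\<eta> + k \<xi>\<close>.\<close>
  have "\<exists>s u. s \<noteq> 0 \<and> matsp.dim (W (pt s u)) \<ge> ind q"
  proof -
    obtain \<xi>0 where \<xi>0: "\<xi>0 \<in> P" "matsp.dim (W \<xi>0) = ind q"
      using assms(9) unfolding W_def matsp.dim_span by blast
    obtain s u where su: "matsp.dim (W (pt s u)) = ind q"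
      using P_pt[OF \<xi>0(1)] \<xi>0(2) by blast
    show ?thesis
    proof (cases "s = 0")
      case True
      have pt_eq: "pt t u = fscale u \<xi> + fscale t \<eta>" for t by (simp only: pt_def add.commute)
      have "finite {t. matsp.dim (W (pt t u)) < matsp.dim (W (pt 0 u))}"
        unfolding pt_eq
        using funsp.subspace_scale[OF subspace_dual_space \<xi>] \<eta> by (intro generic)
      \<comment> \<open>The value 0 joins the exceptional set so that the new coefficient of \<eta>
        is non-zero.\<close>
      then have "finite (insert 0 {t. matsp.dim (W (pt t u)) < matsp.dim (W (pt 0 u))})" by simp
      then obtain t where "t \<notin> insert 0 {t. matsp.dim (W (pt t u)) < matsp.dim (W (pt 0 u))}"
        using inf ex_new_if_finite by blast
      then show ?thesis using su True by (intro exI[of _ t] exI[of _ u]) auto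
    next
      case False
      then show ?thesis using su by (intro exI[of _ s] exI[of _ u]) simp
    qed
  qed
  then obtain s u where su: "s \<noteq> 0" "matsp.dim (W (pt s u)) \<ge> ind q" by blast
  have "pt s u = fscale s (pt 1 (u / s))"
    using su(1) by (simp add: pt_def funsp.scale_right_distrib)
  then have t1: "matsp.dim (W (pt 1 (u / s))) \<ge> ind q"
    using su(2) dim_differentials_dilate_le[OF su(1) pt_dual[of 1 "u / s"]] unfolding W_def by simp
  \<comment> \<open>The good parameters: there the differentials of the centre, always contained in
    the kernel, fill it.\<close>
  define S where "S = {t. matsp.span (W (pt 1 t)) = ker 1 t}"
  have pt1: "pt 1 t = \<eta> + fscale t \<xi>" for t by (simp add: pt_def)
  have "t \<in> S" if "\<not> matsp.dim (W (pt 1 t)) < matsp.dim (W (pt 1 (u / s)))" for t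
  proof -
    have "matsp.dim (ker 1 t) \<le> matsp.dim (matsp.span (W (pt 1 t)))"
      using that t1 rank[of 1 t] by simp
    moreover have "matsp.span (W (pt 1 t)) \<subseteq> ker 1 t"
      using W_ker ker_sub by (rule matsp.span_minimal)
    ultimately show ?thesis
      unfolding S_def using fd.subspace_dim_equal[OF matsp.subspace_span ker_sub] by blast
  qed
  then have "- S \<subseteq> {t. matsp.dim (W (pt 1 t)) < matsp.dim (W (pt 1 (u / s)))}" by blast
  moreover have "finite {t. matsp.dim (W (pt 1 t)) < matsp.dim (W (pt 1 (u / s)))}"
    unfolding pt1 by (rule generic[OF \<eta> \<xi>])
  ultimately have "finite (- S)" by (rule finite_subset)
  then have infS: "infinite S" using inf by (metis Compl_partition finite_Un)

  define H where "H = {shift q \<xi> f j | f j. f \<in> poisson_centre q \<and> j < poly_degree q f}"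
  define L where "L = matsp.span {differential q f \<eta> | f. f \<in> H}"
  have "H \<subseteq> symmetric_algebra q"
    unfolding H_def using shift_in_symmetric_algebra[OF Z_sym \<xi>] by blast
  then have L_eq: "matsp.span {differential q f \<eta> | f. f \<in> shift_algebra q \<xi> (poisson_centre q)} = L"
    unfolding L_def shift_algebra_def H_def[symmetric]
    by (rule span_differentials_generated_algebra[OF _ \<eta>])
  have expand: "differential q f (pt 1 a)
      = (\<Sum>j<poly_degree q f. mscale (a ^ j) (differential q (shift q \<xi> f j) \<eta>))"
    if "f \<in> poisson_centre q" for f a
    unfolding pt1 by (rule differential_shifted[OF degree_le_poly_degree[OF Z_sym[OF that]] \<eta> \<xi>])
  have L_S: "L = matsp.span (\<Union>a\<in>S - {c}. ker 1 a)" for c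
  proof (rule subset_antisym)
    let ?U = "matsp.span (\<Union>a\<in>S - {c}. ker 1 a)"
    \<comment> \<open>For infinitely many a the expanded differential lies in \<open>?U\<close>, so
      each of its coefficients does; deleting \<open>c\<close> leaves infinitely many.\<close>
    have "differential q (shift q \<xi> f j) \<eta> \<in> ?U" if f: "f \<in> poisson_centre q" and j: "j < poly_degree q f" for f j
    proof (rule matsp.poly_curve_coefficients[OF _ matsp.subspace_span _ j])
      show "infinite (S - {c})" using infS by simp
      fix a assume a: "a \<in> S - {c}"
      have "differential q f (pt 1 a) \<in> ker 1 a" using W_ker[of 1 a] f unfolding W_def by blast
      then show "(\<Sum>i<poly_degree q f. mscale (a ^ i) (differential q (shift q \<xi> f i) \<eta>)) \<in> ?U"
        unfolding expand[OF f, symmetric] using a by (intro matsp.span_base) blast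
    qed
    then show "L \<subseteq> ?U"
      unfolding L_def H_def by (intro matsp.span_minimal matsp.subspace_span) blast
    \<comment> \<open>Conversely, every differential on the line is a combination of those of the
      shifts; for a in \<open>S\<close> these span the whole kernel.\<close>
    have "differential q f (pt 1 a) \<in> L" if f: "f \<in> poisson_centre q" for f a
      unfolding expand[OF f] L_def H_def using f
      by (intro matsp.span_sum matsp.span_scale matsp.span_base) auto
    then have "matsp.span (W (pt 1 a)) \<subseteq> L" for a
      unfolding L_def by (intro matsp.span_minimal matsp.subspace_span) (auto simp: W_def)
    then show "?U \<subseteq> L"
      unfolding L_def by (intro matsp.span_minimal matsp.subspace_span) (auto simp: S_def)
  qed
  have "2 * matsp.dim L = matsp.dim q + ind q"
  proof (rule fd.dim_sum_of_pencil_kernels[OF sub A B])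
    show "S \<noteq> {}" using infS by auto
    show "L = matsp.span (\<Union>a\<in>S - {c}. {x\<in>q. \<forall>y\<in>q. 1 * A x y + a * B x y = 0})" for c
      using L_S[of c] unfolding ker_def .
    show "matsp.dim {x\<in>q. \<forall>y\<in>q. s * A x y + t * B x y = 0} = ind q" if "(s, t) \<noteq> (0, 0)" for s t
      using rank[OF that] unfolding ker_def .
  qed (rule skew)+
  then show ?thesis unfolding L_eq b_invariant_def by simp
qed

end
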